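(* Let $1\le p\le n$. The collection of maps $\{R^f_U \mid U\in \operatorname{SpSt}(2n,2p)\}$ given by $$R^f_U(D) = \left(U\exp_m(U^+D) + (I_{2n}-UU^+)D\right)G_f(U,D),\qquad D\in T_U\operatorname{SpSt}(2n,2p),$$ with $G_f(U,D)$ as defined in the context, constitutes a retraction on the real symplectic Stiefel manifold $\operatorname{SpSt}(2n,2p)$, where each $R^f_U$ is defined on the open subset around $0$ of $T_U\operatorname{SpSt}(2n,2p)$ consisting of those $D$ for which $G_f(U,D)$ is well-defined.
   Context: Notation. $I_k$ is the $k\times k$ identity matrix, $J_k=\begin{bmatrix}0&I_k\\-I_k&0\end{bmatrix}\in\mathbb{R}^{2k\times 2k}$. For $A\in\mathbb{R}^{2n\times 2p}$ the symplectic inverse is $A^+:=J_p^TA^TJ_n\in\mathbb{R}^{2p\times 2n}$. The real symplectic Stiefel manifold is $$\operatorname{SpSt}(2n,2p)=\{U\in\mathbb{R}^{2n\times 2p}\mid U^+U=I_{2p}\}=\{U\in\mathbb{R}^{2n\times 2p}\mid U^TJ_nU=J_p\},$$ regarded as an embedded submanifold of $\mathbb{R}^{2n\times 2p}$. With $\mathfrak{sp}(2p,\mathbb{R})=\{\Omega\in\mathbb{R}^{2p\times 2p}\mid (J_p\Omega)^T=J_p\Omega\}$ (Hamiltonian matrices), its tangent space at $U$ is $T_U\operatorname{SpSt}(2n,2p)=\{D\in\mathbb{R}^{2n\times 2p}\mid U^+D\in\mathfrak{sp}(2p,\mathbb{R})\}$. $\exp_m$ denotes the matrix exponential. Definition of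 $G_f$. For $U\in\operatorname{SpSt}(2n,2p)$ and $D\in T_U\operatorname{SpSt}(2n,2p)$ put $$K=K(U,D):=J_p+D^TJ_nD-(U^+D)^TJ_p(U^+D)\in\mathbb{R}^{2p\times 2p}$$ (this equals $\Delta^TJ_n\Delta$ for $\Delta=U\exp_m(U^+D)+(I_{2n}-UU^+)D$). Let $M:=\sqrt{-KJ_p}$ be the principal (primary) matrix square root, and set $G_f=G_f(U,D):=M^{-T}=(M^{T})^{-1}$. This is well-defined if $-KJ_p$ has no eigenvalues on the closed negative real axis $(-\infty,0]$. Retraction. A retraction on a manifold $\mathcal{M}$ is a smooth mapping $R$ from the tangent bundle $T\mathcal{M}$ to $\mathcal{M}$, $R(x,v)=R_x(v)$, such that for all $x\in\mathcal{M}$: (1) $R_x$ maps $T_x\mathcal{M}$ to $\mathcal{M}$; (2) $R_x(0)=x$; (3) the differential of $R_x$ at $0$ is the identity, $d(R_x)_0=\mathrm{id}_{T_x\mathcal{M}}$. It is allowed that each $R_x$ is defined only on an open subset around $0$ of $T_x\mathcal{M}$ (with smoothness jointly in $(x,v)$ on the resulting open domain in $T\mathcal{M}$). *)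

theory Defs
  imports "HOL-Analysis.Analysis"
begin

text \<open>A real \<open>2n \<times> 2p\<close> matrix has type \<open>real^('p + 'p)^('n + 'n)\<close> (columns first), where
  \<open>n = CARD('n)\<close>, \<open>p = CARD('p)\<close>; the two summands of the index type are the two blocks of
  rows or columns.\<close>

section \<open>Matrix exponential and principal square root\<close>

text \<open>On \<open>real^'k^'k\<close> the type class product is componentwise, so the powers and the exponential
  series are formed with \<open>**\<close> instead of \<open>power\<close> and \<open>exp\<close>.\<close>

primrec mat_power :: "real^'k^'k \<Rightarrow> nat \<Rightarrow> real^'k^'k" where
  "mat_power A 0 = mat 1"
| "mat_power A (Suc m) = A ** mat_power A m"

definition mat_exp :: "real^'k^'k \<Rightarrow> real^'k^'k" where
  "mat_exp A = (\<Sum>m. (1 / fact m) *\<^sub>R mat_power A m)"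

definition complex_eigenvalue :: "real^'k^'k \<Rightarrow> complex \<Rightarrow> bool" where
  "complex_eigenvalue A z \<longleftrightarrow>
     (\<exists>v :: complex^'k. v \<noteq> 0 \<and> map_matrix complex_of_real A *v v = z *s v)"

definition no_nonpos_eigenvalue :: "real^'k^'k \<Rightarrow> bool" where
  "no_nonpos_eigenvalue A \<longleftrightarrow> (\<forall>z. complex_eigenvalue A z \<longrightarrow> z \<notin> \<real>\<^sub>\<le>\<^sub>0)"

text \<open>The principal square root is the unique square root with spectrum in the open right
  half-plane; it exists, and is real for real \<open>A\<close>, whenever \<open>no_nonpos_eigenvalue A\<close>.\<close>

definition principal_sqrt :: "real^'k^'k \<Rightarrow> real^'k^'k" where
  "principal_sqrt A = (THE X. X ** X = A \<and> (\<forall>z. complex_eigenvalue X z \<longrightarrow> Re z > 0))"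

section \<open>The real symplectic Stiefel manifold\<close>

definition Jmat :: "real^('k::finite + 'k)^('k + 'k)" where
  "Jmat = (\<chi> i j. case (i, j) of
       (Inl a, Inr b) \<Rightarrow> (if a = b then 1 else 0)
     | (Inr a, Inl b) \<Rightarrow> (if a = b then - 1 else 0)
     | _ \<Rightarrow> 0)"

definition sp_inv :: "real^('p::finite + 'p)^('n::finite + 'n) \<Rightarrow> real^('n + 'n)^('p + 'p)" where
  "sp_inv A = transpose Jmat ** transpose A ** Jmat"

definition SpSt :: "(real^('p::finite + 'p)^('n::finite + 'n)) set" where
  "SpSt = {U. sp_inv U ** U = mat 1}"

definition hamiltonian :: "(real^('p::finite + 'p)^('p + 'p)) set" where
  "hamiltonian = {\<Omega>. transpose (Jmat ** \<Omega>) = Jmat ** \<Omega>}"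

definition SpSt_tangent ::
    "real^('p::finite + 'p)^('n::finite + 'n) \<Rightarrow> (real^('p + 'p)^('n + 'n)) set" where
  "SpSt_tangent U = {D. sp_inv U ** D \<in> hamiltonian}"

section \<open>The maps \<open>G\<^sub>f\<close> and \<open>R\<^sup>f\<close>\<close>

definition Kmat :: "real^('p::finite + 'p)^('n::finite + 'n) \<Rightarrow> real^('p + 'p)^('n + 'n) \<Rightarrow>
    real^('p + 'p)^('p + 'p)" where
  "Kmat U D = Jmat + transpose D ** Jmat ** D
     - transpose (sp_inv U ** D) ** Jmat ** (sp_inv U ** D)"

definition Gf_dom :: "real^('p::finite + 'p)^('n::finite + 'n) \<Rightarrow> (real^('p + 'p)^('n + 'n)) set"
  where "Gf_dom U = {D \<in> SpSt_tangent U. no_nonpos_eigenvalue (- Kmat U D ** Jmat)}"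

definition Gf :: "real^('p::finite + 'p)^('n::finite + 'n) \<Rightarrow> real^('p + 'p)^('n + 'n) \<Rightarrow>
    real^('p + 'p)^('p + 'p)" where
  "Gf U D = matrix_inv (transpose (principal_sqrt (- Kmat U D ** Jmat)))"

definition Rf :: "real^('p::finite + 'p)^('n::finite + 'n) \<Rightarrow> real^('p + 'p)^('n + 'n) \<Rightarrow>
    real^('p + 'p)^('n + 'n)" where
  "Rf U D = (U ** mat_exp (sp_inv U ** D) + (mat 1 - U ** sp_inv U) ** D) ** Gf U D"

section \<open>Smooth maps and retractions\<close>

text \<open>\<open>C_k_on k W f\<close> is meant for open \<open>W\<close>: in finite dimension, \<open>f\<close> is \<open>k\<close> times continuously
  differentiable iff it is differentiable and all its directional derivatives are \<open>k - 1\<close> times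
  continuously differentiable.\<close>

primrec C_k_on :: "nat \<Rightarrow> 'a::euclidean_space set \<Rightarrow> ('a \<Rightarrow> 'b::euclidean_space) \<Rightarrow> bool" where
  "C_k_on 0 W f \<longleftrightarrow> continuous_on W f"
| "C_k_on (Suc k) W f \<longleftrightarrow> (\<forall>x\<in>W. f differentiable (at x)) \<and>
     (\<forall>v. C_k_on k W (\<lambda>x. frechet_derivative f (at x) v))"

text \<open>For a subset \<open>S\<close> of Euclidean space, smoothness means local extendability to a \<open>C\<^sup>\<infinity>\<close>
  map of the ambient space. For (relatively open subsets of) embedded submanifolds, such as a tangent
  bundle inside the square of the ambient space, this is smoothness in the sense of manifolds.\<close>

definition smooth_map_on :: "'a::euclidean_space set \<Rightarrow> ('a \<Rightarrow> 'b::euclidean_space) \<Rightarrow> bool" where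
  "smooth_map_on S f \<longleftrightarrow> (\<forall>x\<in>S. \<exists>W g. open W \<and> x \<in> W \<and> (\<forall>k. C_k_on k W g) \<and>
     (\<forall>y\<in>W \<inter> S. g y = f y))"

text \<open>\<open>M\<close> is an embedded submanifold of \<open>'a\<close> with tangent spaces \<open>T x\<close>, each a linear subspace of
  \<open>'a\<close>, so its tangent bundle is \<open>Sigma M T\<close>; \<open>R x\<close> is defined on \<open>Dom x\<close>. As \<open>Dom x\<close> is
  relatively open in \<open>T x\<close>, the derivative at \<open>0\<close> within \<open>Dom x\<close> is the differential on \<open>T x\<close>.\<close>

definition is_retraction ::
    "'a::euclidean_space set \<Rightarrow> ('a \<Rightarrow> 'a set) \<Rightarrow> ('a \<Rightarrow> 'a set) \<Rightarrow> ('a \<Rightarrow> 'a \<Rightarrow> 'a) \<Rightarrow> bool" where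
  "is_retraction M T Dom R \<longleftrightarrow>
     (\<forall>x\<in>M. openin (top_of_set (T x)) (Dom x) \<and> 0 \<in> Dom x) \<and>
     openin (top_of_set (Sigma M T)) (Sigma M Dom) \<and>
     smooth_map_on (Sigma M Dom) (\<lambda>(x, v). R x v) \<and>
     (\<forall>x\<in>M. R x ` Dom x \<subseteq> M) \<and>
     (\<forall>x\<in>M. R x 0 = x) \<and>
     (\<forall>x\<in>M. (R x has_derivative (\<lambda>v. v)) (at 0 within Dom x))"

end

theory Submission
  imports Defs "HOL-Computational_Algebra.Fundamental_Theorem_Algebra"
begin

text \<open>Write \<open>J\<close> for \<open>Jmat\<close>, \<open>H = U\<^sup>+ D\<close> and \<open>\<Delta> = U exp H + (I - U U\<^sup>+) D\<close>, so that \<open>Rf U D = \<Delta> G\<close>.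

  That \<open>Rf U D\<close> is symplectic is algebra. Since \<open>H\<close> is Hamiltonian, \<open>exp H\<close> is symplectic, and since
  \<open>U\<^sup>T J (I - U U\<^sup>+) = 0\<close>, the mixed terms in \<open>\<Delta>\<^sup>T J \<Delta>\<close> vanish and \<open>\<Delta>\<^sup>T J \<Delta> = K\<close>
  (\<open>Kmat_eq_pre_retraction\<close>). Being a skew form, \<open>K\<close> makes \<open>N = - K J\<close> satisfy
  \<open>N = J N\<^sup>T J\<^sup>-\<^sup>1\<close>. If \<open>M\<close> is the principal square root of \<open>N\<close>, then \<open>J M\<^sup>T J\<^sup>-\<^sup>1\<close> is another
  square root of \<open>N\<close> with the same spectrum, so it equals \<open>M\<close>; this reads \<open>M J = J M\<^sup>T\<close> and gives
  \<open>K = N J = M M J = M J M\<^sup>T\<close> (\<open>principal_sqrt_skew_factor\<close>). Therefore \<open>G = M\<^sup>-\<^sup>T\<close> satisfies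
  \<open>G\<^sup>T K G = J\<close> (\<open>Rf_in_SpSt\<close>).

  The differential at \<open>0\<close> is easy as well: \<open>K\<close> is \<open>J\<close> plus terms quadratic in \<open>D\<close>, so \<open>G\<close> is
  stationary at \<open>D = 0\<close>, and the derivative of \<open>\<Delta>\<close> in direction \<open>v\<close> is
  \<open>U U\<^sup>+ v + (I - U U\<^sup>+) v = v\<close> (\<open>Rf_has_derivative_0\<close>).

  The work is in the analysis of the two matrix functions. The exponential is a power series in a
  noncommutative variable; all its iterated directional derivatives are given by one explicit
  family of series with a geometric-over-factorial majorant (\<open>mat_exp_deriv_has_derivative\<close>). The
  square root needs three things. Uniqueness: the difference \<open>Z\<close> of two square roots \<open>X\<close>, \<open>Y\<close>
  solves the Sylvester equation \<open>X Z + Z Y = 0\<close>, which has only the zero solution if both spectra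
  lie in the open right half-plane (\<open>sylvester_injective\<close>). Existence: some polynomial \<open>r\<close> satisfies
  \<open>r\<^sup>2 = x\<close> modulo an annihilating polynomial of the matrix and takes values of positive real part
  at its eigenvalues (\<open>poly_sqrt_mod\<close>); uniqueness makes the root of a real matrix real.
  Smoothness: the derivative \<open>H \<mapsto> X H + H X\<close> of squaring is injective by the same Sylvester
  argument, so the inverse function theorem gives differentiability, and the derivative of the root
  solves a linear equation whose coefficients are as smooth as the root itself. Such solutions
  inherit the smoothness of the coefficients (\<open>C_k_on_bilinear_solution\<close>), which bootstraps the root
  to every \<open>C\<^sup>k\<close> and also covers matrix inversion.\<close>

section \<open>Matrix algebra\<close>

lemma mat_mult_diff_right: "(A :: 'a::ring_1^'n::finite^'m::finite) ** (B - C) = A ** B - A ** C"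
  by (simp add: matrix_matrix_mult_def vec_eq_iff algebra_simps sum_subtractf)

lemma mat_mult_diff_left: "((A :: 'a::ring_1^'n::finite^'m::finite) - B) ** C = A ** C - B ** C"
  by (simp add: matrix_matrix_mult_def vec_eq_iff algebra_simps sum_subtractf)

lemma mat_mult_add_left: "((A :: 'a::ring_1^'n::finite^'m::finite) + B) ** C = A ** C + B ** C"
  by (simp add: matrix_matrix_mult_def vec_eq_iff algebra_simps sum.distrib)

lemma mat_mult_minus_right: "(A :: 'a::ring_1^'n::finite^'m::finite) ** (- B) = - (A ** B)"
  by (simp add: matrix_matrix_mult_def vec_eq_iff sum_negf)

lemma mat_mult_minus_left: "(- (A :: 'a::ring_1^'n::finite^'m::finite)) ** B = - (A ** B)"
  by (simp add: matrix_matrix_mult_def vec_eq_iff sum_negf)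

lemma mat_mult_zero_left [simp]: "(0 :: 'a::semiring_1^'n::finite^'m::finite) ** A = 0"
  by (simp add: matrix_matrix_mult_def vec_eq_iff)

lemma mat_mult_zero_right [simp]: "(A :: 'a::semiring_1^'n::finite^'m::finite) ** 0 = 0"
  by (simp add: matrix_matrix_mult_def vec_eq_iff)

lemma transpose_minus: "transpose (- A) = - transpose A"
  by (simp add: transpose_def vec_eq_iff)

lemma transpose_add: "transpose (A + B) = transpose A + transpose B"
  by (simp add: transpose_def vec_eq_iff)

lemma transpose_diff: "transpose (A - B) = transpose A - transpose B"
  by (simp add: transpose_def vec_eq_iff)

lemma bounded_bilinear_matrix_mult:
  "bounded_bilinear ((**) :: real^'b::finite^'a::finite \<Rightarrow> real^'c::finite^'b \<Rightarrow> real^'c^'a)"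
  unfolding bilinear_conv_bounded_bilinear[symmetric]
  by (auto simp: bilinear_def linear_iff matrix_matrix_mult_def vec_eq_iff sum.distrib
      algebra_simps sum_distrib_left)

lemmas matrix_mult_has_derivative = bounded_bilinear.FDERIV[OF bounded_bilinear_matrix_mult]

lemma bounded_linear_transpose: "bounded_linear (transpose :: real^'n::finite^'m::finite \<Rightarrow> _)"
  unfolding linear_conv_bounded_linear[symmetric] by (auto simp: linear_iff transpose_def vec_eq_iff)

lemma matrix_inv_mult:
  fixes A :: "'a::semiring_1^'n::finite^'m::finite"
  assumes "invertible A" shows "A ** matrix_inv A = mat 1" "matrix_inv A ** A = mat 1"
  using someI_ex[OF assms[unfolded invertible_def]] unfolding matrix_inv_def by auto

lemma matrix_inv_mat_1: "matrix_inv (mat 1 :: real^'k::finite^'k) = mat 1"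
  by (metis invertible_def matrix_inv_mult(1) matrix_mul_lid)

section \<open>Calculus of \<open>C\<^sup>k\<close> maps\<close>

lemma C_k_on_cong:
  assumes "open W" "\<And>x. x \<in> W \<Longrightarrow> f x = g x" "C_k_on k W f"
  shows "C_k_on k W g"
  using assms(2,3)
proof (induction k arbitrary: f g)
  case 0
  then show ?case by (simp cong: continuous_on_cong)
next
  case (Suc k)
  have der: "(g has_derivative frechet_derivative f (at x)) (at x)" if "x \<in> W" for x
  proof -
    have "(f has_derivative frechet_derivative f (at x)) (at x)"
      using Suc.prems that frechet_derivative_works by auto
    then show ?thesis
      using has_derivative_transform_within_open[OF _ assms(1) that] Suc.prems(1) by blast
  qed
  show ?case unfolding C_k_on.simps
  proof safe
    fix x assume "x \<in> W" then show "g differentiable at x" using der differentiableI by blast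
  next
    fix v
    show "C_k_on k W (\<lambda>x. frechet_derivative g (at x) v)"
    proof (rule Suc.IH)
      show "C_k_on k W (\<lambda>x. frechet_derivative f (at x) v)" using Suc.prems by auto
      show "frechet_derivative f (at x) v = frechet_derivative g (at x) v" if "x \<in> W" for x
        using frechet_derivative_at[OF der[OF that]] by (rule fun_cong)
    qed
  qed
qed

text \<open>Lets \<open>C_k_on\<close> be established from an explicit formula for the derivative.\<close>

lemma C_k_on_SucI:
  assumes "open W" "\<And>x. x \<in> W \<Longrightarrow> (f has_derivative f' x) (at x)"
    and "\<And>v. C_k_on k W (\<lambda>x. f' x v)"
  shows "C_k_on (Suc k) W f"
  unfolding C_k_on.simps
proof safe
  fix x assume "x \<in> W" then show "f differentiable at x" using assms(2) differentiableI by blast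
next
  fix v
  show "C_k_on k W (\<lambda>x. frechet_derivative f (at x) v)"
  proof (rule C_k_on_cong[OF assms(1) _ assms(3)[of v]])
    show "f' x v = frechet_derivative f (at x) v" if "x \<in> W" for x
      using frechet_derivative_at[OF assms(2)[OF that]] by (rule fun_cong)
  qed
qed

lemma C_k_on_has_derivative:
  "C_k_on (Suc k) W f \<Longrightarrow> x \<in> W \<Longrightarrow> (f has_derivative frechet_derivative f (at x)) (at x)"
  by (simp add: frechet_derivative_works)

lemma C_k_on_pred: "C_k_on (Suc k) W f \<Longrightarrow> C_k_on k W f"
proof (induction k arbitrary: f)
  case 0
  then show ?case
    by (auto intro!: continuous_at_imp_continuous_on differentiable_imp_continuous_within)
next
  case (Suc k)
  show ?case using Suc.prems Suc.IH by auto
qed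

lemma C_k_on_const: "open W \<Longrightarrow> C_k_on k W (\<lambda>x. c)"
proof (induction k arbitrary: c)
  case (Suc k)
  show ?case by (rule C_k_on_SucI[where f' = "\<lambda>x v. 0"]) (use Suc in auto)
qed auto

lemma C_k_on_linear:
  assumes "bounded_linear L" "open W" shows "C_k_on k W L"
proof (cases k)
  case 0
  then show ?thesis using assms by (simp add: linear_continuous_on)
next
  case (Suc m)
  have "C_k_on (Suc m) W L"
    by (rule C_k_on_SucI[where f' = "\<lambda>x. L"])
      (use assms C_k_on_const bounded_linear_imp_has_derivative in auto)
  then show ?thesis using Suc by simp
qed

lemma C_k_on_linear_compose:
  assumes L: "bounded_linear L" and "open W" "C_k_on k W f" shows "C_k_on k W (\<lambda>x. L (f x))"
  using assms(3)
proof (induction k arbitrary: f)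
  case 0
  then show ?case using L by (simp add: bounded_linear.continuous_on)
next
  case (Suc k)
  show ?case
  proof (rule C_k_on_SucI[OF assms(2)])
    show "((\<lambda>x. L (f x)) has_derivative (\<lambda>v. L (frechet_derivative f (at x) v))) (at x)"
      if "x \<in> W" for x
      by (rule bounded_linear.has_derivative[OF L C_k_on_has_derivative[OF Suc.prems that]])
  qed (use Suc in auto)
qed

lemma C_k_on_add:
  assumes "open W" "C_k_on k W f" "C_k_on k W g" shows "C_k_on k W (\<lambda>x. f x + g x)"
  using assms(2,3)
proof (induction k arbitrary: f g)
  case 0
  then show ?case by (simp add: continuous_on_add)
next
  case (Suc k)
  show ?case
  proof (rule C_k_on_SucI[OF assms(1)])
    show "((\<lambda>x. f x + g x) has_derivative (\<lambda>v. frechet_derivative f (at x) v + frechet_derivative g (at x) v)) (at x)"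
      if "x \<in> W" for x
      by (rule has_derivative_add[OF C_k_on_has_derivative[OF Suc.prems(1) that]
            C_k_on_has_derivative[OF Suc.prems(2) that]])
  qed (use Suc in auto)
qed

lemma C_k_on_uminus:
  assumes "open W" "C_k_on k W f" shows "C_k_on k W (\<lambda>x. - f x)"
  by (rule C_k_on_linear_compose[OF _ assms]) (rule bounded_linear_minus[OF bounded_linear_ident])

lemma C_k_on_diff:
  assumes "open W" "C_k_on k W f" "C_k_on k W g" shows "C_k_on k W (\<lambda>x. f x - g x)"
  using C_k_on_add[OF assms(1,2) C_k_on_uminus[OF assms(1,3)]] by simp

lemma C_k_on_sum:
  assumes "open W" "finite I" "\<And>i. i \<in> I \<Longrightarrow> C_k_on k W (f i)"
  shows "C_k_on k W (\<lambda>x. \<Sum>i\<in>I. f i x)"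
  using assms(2,3)
proof (induction I rule: finite_induct)
  case empty then show ?case using C_k_on_const[OF assms(1)] by simp
next
  case (insert i I)
  then show ?case using C_k_on_add[OF assms(1), of k "f i"] by simp
qed

lemma C_k_on_bilinear:
  assumes B: "bounded_bilinear B" and W: "open W" and "C_k_on k W f" "C_k_on k W g"
  shows "C_k_on k W (\<lambda>x. B (f x) (g x))"
  using assms(3,4)
proof (induction k arbitrary: f g)
  case 0
  then show ?case using bounded_bilinear.continuous_on[OF B] by auto
next
  case (Suc k)
  show ?case
  proof (rule C_k_on_SucI[OF W])
    show "((\<lambda>x. B (f x) (g x)) has_derivative
        (\<lambda>v. B (f x) (frechet_derivative g (at x) v) + B (frechet_derivative f (at x) v) (g x))) (at x)"
      if "x \<in> W" for x
      by (rule bounded_bilinear.FDERIV[OF B C_k_on_has_derivative[OF Suc.prems(1) that]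
            C_k_on_has_derivative[OF Suc.prems(2) that]])
    show "C_k_on k W (\<lambda>x. B (f x) (frechet_derivative g (at x) v) + B (frechet_derivative f (at x) v) (g x))" for v
      by (intro C_k_on_add[OF W] Suc.IH C_k_on_pred[OF Suc.prems(1)] C_k_on_pred[OF Suc.prems(2)])
        (use Suc.prems in auto)
  qed
qed

text \<open>The derivative of a composition in direction \<open>v\<close> is \<open>g'(f x)\<close> applied to a vector that depends
  on \<open>x\<close>, while \<open>C_k_on\<close> speaks of fixed directions only. Expanding that vector in the standard
  basis turns the chain rule into a finite sum of products of \<open>C\<^sup>k\<close> maps.\<close>

lemma C_k_on_compose:
  fixes f :: "'a::euclidean_space \<Rightarrow> 'b::euclidean_space" and g :: "'b \<Rightarrow> 'c::euclidean_space"
  assumes W: "open W" and V: "open V" and "f ` W \<subseteq> V" "C_k_on k V g" "C_k_on k W f"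
  shows "C_k_on k W (\<lambda>x. g (f x))"
  using assms(3-5)
proof (induction k arbitrary: g)
  case 0
  then show ?case using continuous_on_compose2 by auto
next
  case (Suc k)
  let ?f' = "\<lambda>x. frechet_derivative f (at x)" and ?g' = "\<lambda>y. frechet_derivative g (at y)"
  show ?case
  proof (rule C_k_on_SucI[OF W])
    fix x assume x: "x \<in> W"
    have g': "(g has_derivative ?g' (f x)) (at (f x))"
      using Suc.prems x C_k_on_has_derivative by blast
    have "((\<lambda>x. g (f x)) has_derivative (\<lambda>v. ?g' (f x) (?f' x v))) (at x)"
      using has_derivative_compose[OF C_k_on_has_derivative[OF Suc.prems(3) x] g'] .
    moreover have "(\<lambda>v. ?g' (f x) (?f' x v)) = (\<lambda>v. \<Sum>b\<in>Basis. (?f' x v \<bullet> b) *\<^sub>R ?g' (f x) b)"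
    proof -
      have L: "linear (?g' (f x))" using g' has_derivative_linear by blast
      have "?g' (f x) w = (\<Sum>b\<in>Basis. (w \<bullet> b) *\<^sub>R ?g' (f x) b)" for w
      proof -
        have "?g' (f x) w = ?g' (f x) (\<Sum>b\<in>Basis. (w \<bullet> b) *\<^sub>R b)"
          by (simp add: euclidean_representation)
        also have "\<dots> = (\<Sum>b\<in>Basis. (w \<bullet> b) *\<^sub>R ?g' (f x) b)"
          by (simp add: linear_sum[OF L] linear_cmul[OF L])
        finally show ?thesis .
      qed
      then show ?thesis by (intro ext)
    qed
    ultimately show "((\<lambda>x. g (f x)) has_derivative
        (\<lambda>v. \<Sum>b\<in>Basis. (?f' x v \<bullet> b) *\<^sub>R ?g' (f x) b)) (at x)"
      by (simp only:)
  next
    fix v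
    show "C_k_on k W (\<lambda>x. \<Sum>b\<in>Basis. (?f' x v \<bullet> b) *\<^sub>R ?g' (f x) b)"
    proof (intro C_k_on_sum[OF W] C_k_on_bilinear[OF bounded_bilinear_scaleR W])
      fix b :: 'b
      show "C_k_on k W (\<lambda>x. ?f' x v \<bullet> b)"
        by (rule C_k_on_linear_compose[OF bounded_linear_inner_left W]) (use Suc.prems in auto)
      show "C_k_on k W (\<lambda>x. ?g' (f x) b)"
        by (intro Suc.IH C_k_on_pred[OF Suc.prems(3)]) (use Suc.prems in auto)
    qed auto
  qed
qed

section \<open>Solutions of bilinear equations\<close>

text \<open>An injective linear map on a finite-dimensional space is bounded below by some \<open>c > 0\<close>. Near \<open>x\<close>
  the coefficient \<open>S y\<close> differs from \<open>S x\<close> by an operator of norm at most \<open>c / 2\<close>, so the part of the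
  error that is proportional to \<open>H y - H x\<close> can be absorbed in the left-hand side.\<close>

lemma isCont_bilinear_solution:
  fixes S :: "'a::euclidean_space \<Rightarrow> 'b::euclidean_space" and H :: "'a \<Rightarrow> 'c::euclidean_space"
    and V :: "'a \<Rightarrow> 'd::euclidean_space"
  assumes B: "bounded_bilinear B" and W: "open W" "x \<in> W"
    and eq: "\<And>y. y \<in> W \<Longrightarrow> B (S y) (H y) = V y"
    and inj: "\<And>h. B (S x) h = 0 \<Longrightarrow> h = 0"
    and S: "isCont S x" and V: "isCont V x"
  shows "isCont H x"
proof -
  interpret B: bounded_bilinear B by (fact B)
  have lin: "linear (B (S x))" using B.bounded_linear_right bounded_linear.linear by blast
  have "inj (B (S x))" using inj linear_injective_0[OF lin] by blast
  then obtain c where c: "c > 0" "\<And>h. c * norm h \<le> norm (B (S x) h)"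
    using linear_inj_bounded_below_pos[OF lin] by blast
  obtain K where K: "K > 0" "\<And>a b. norm (B a b) \<le> norm a * norm b * K"
    using B.pos_bounded by blast
  have split: "B (S x) (H y - H x) = V y - V x - B (S y - S x) (H y - H x) - B (S y - S x) (H x)"
    if "y \<in> W" for y
    using eq[OF that] eq[OF W(2)] by (simp add: B.diff_left B.diff_right)
  have ev: "\<forall>\<^sub>F y in at x. norm (H y - H x)
      \<le> (norm (V y - V x) + norm (S y - S x) * norm (H x) * K) * (2 / c)"
  proof -
    have "\<forall>\<^sub>F y in at x. dist (S y) (S x) < c / (2 * K)"
      using S c(1) K(1) by (intro tendstoD) (auto simp: isCont_def)
    moreover have "\<forall>\<^sub>F y in at x. y \<in> W" using W by (simp add: eventually_at_topological) blast
    ultimately show ?thesis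
    proof eventually_elim
      case (elim y)
      have "c * norm (H y - H x) \<le> norm (V y - V x - B (S y - S x) (H y - H x) - B (S y - S x) (H x))"
        using c(2)[of "H y - H x"] split[OF elim(2)] by simp
      also have "\<dots> \<le> norm (V y - V x) + norm (B (S y - S x) (H y - H x)) + norm (B (S y - S x) (H x))"
        using norm_triangle_ineq4[of "V y - V x - B (S y - S x) (H y - H x)" "B (S y - S x) (H x)"]
          norm_triangle_ineq4[of "V y - V x" "B (S y - S x) (H y - H x)"] by linarith
      also have "\<dots> \<le> norm (V y - V x) + norm (S y - S x) * K * norm (H y - H x)
          + norm (S y - S x) * norm (H x) * K"
        using K(2)[of "S y - S x" "H y - H x"] K(2)[of "S y - S x" "H x"] by (simp add: ac_simps)
      also have "norm (S y - S x) * K * norm (H y - H x) \<le> c / 2 * norm (H y - H x)"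
        using elim(1) K(1) by (intro mult_right_mono) (auto simp: dist_norm field_simps)
      finally show ?case using c(1) by (simp add: field_simps)
    qed
  qed
  have "((\<lambda>y. (norm (V y - V x) + norm (S y - S x) * norm (H x) * K) * (2 / c)) \<longlongrightarrow>
      (norm (V x - V x) + norm (S x - S x) * norm (H x) * K) * (2 / c)) (at x)"
    by (intro tendsto_mult tendsto_add tendsto_norm tendsto_diff tendsto_const)
      (use S V in \<open>simp_all add: isCont_def\<close>)
  then have "((\<lambda>y. (norm (V y - V x) + norm (S y - S x) * norm (H x) * K) * (2 / c)) \<longlongrightarrow> 0) (at x)"
    by simp
  then have "((\<lambda>y. H y - H x) \<longlongrightarrow> 0) (at x)"
    by (rule Lim_null_comparison[OF ev])
  then show ?thesis unfolding isCont_def using Lim_null by blast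
qed

text \<open>The first factor vanishes to first order at \<open>x\<close>, so the variation of a merely continuous \<open>H\<close>
  contributes \<open>o (norm (y - x))\<close>.\<close>

lemma has_derivative_bilinear_increment:
  fixes S :: "'a::real_normed_vector \<Rightarrow> 'b::real_normed_vector"
  assumes B: "bounded_bilinear B" and S: "(S has_derivative S') (at x)" and H: "isCont H x"
  shows "((\<lambda>y. B (S y - S x) (H y)) has_derivative (\<lambda>v. B (S' v) (H x))) (at x)"
proof -
  interpret B: bounded_bilinear B by (fact B)
  obtain K where K: "K > 0" "\<And>a b. norm (B a b) \<le> norm a * norm b * K"
    using B.pos_bounded by blast
  let ?r = "\<lambda>y. (S y - S x - S' (y - x)) /\<^sub>R norm (y - x)"
  have S': "bounded_linear S'" using S has_derivative_bounded_linear by blast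
  obtain C where C: "\<And>v. norm (S' v) \<le> norm v * C" using bounded_linear.bounded[OF S'] by blast
  have r: "(?r \<longlongrightarrow> 0) (at x)" using S unfolding has_derivative_at_within by simp
  have Hx: "((\<lambda>y. H y - H x) \<longlongrightarrow> 0) (at x)" using H Lim_null unfolding isCont_def by blast
  have "((\<lambda>y. B (?r y) (H y) + B (S' (y - x) /\<^sub>R norm (y - x)) (H y - H x)) \<longlongrightarrow> B 0 (H x) + 0) (at x)"
  proof (intro tendsto_add)
    show "((\<lambda>y. B (?r y) (H y)) \<longlongrightarrow> B 0 (H x)) (at x)"
      using r H unfolding isCont_def by (rule B.tendsto)
    have "norm (B (S' (y - x) /\<^sub>R norm (y - x)) (H y - H x)) \<le> norm (H y - H x) * (\<bar>C\<bar> * K)" for y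
    proof -
      have "norm (S' (y - x) /\<^sub>R norm (y - x)) \<le> \<bar>C\<bar>"
      proof (cases "y = x")
        case False
        then have "norm (S' (y - x)) \<le> norm (y - x) * \<bar>C\<bar>"
          using C[of "y - x"] by (smt (verit) mult_left_mono norm_ge_zero)
        then show ?thesis using False by (simp add: field_simps)
      qed simp
      then have "norm (S' (y - x) /\<^sub>R norm (y - x)) * norm (H y - H x) * K \<le> \<bar>C\<bar> * norm (H y - H x) * K"
        using K(1) by (intro mult_right_mono) auto
      then show ?thesis
        using K(2)[of "S' (y - x) /\<^sub>R norm (y - x)" "H y - H x"] by (simp add: ac_simps)
    qed
    then show "((\<lambda>y. B (S' (y - x) /\<^sub>R norm (y - x)) (H y - H x)) \<longlongrightarrow> 0) (at x)"
      by (intro tendsto_0_le[OF Hx, of _ "\<bar>C\<bar> * K"] always_eventually allI) (simp add: dist_norm)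
  qed
  then have "((\<lambda>y. (B (S y - S x) (H y) - B (S x - S x) (H x) - B (S' (y - x)) (H x)) /\<^sub>R norm (y - x))
      \<longlongrightarrow> 0) (at x)"
    by (simp add: B.diff_left B.diff_right B.add_left B.scaleR_left B.zero_left algebra_simps)
  moreover have "bounded_linear (\<lambda>v. B (S' v) (H x))"
    using bounded_linear_compose[OF B.bounded_linear_left S'] .
  ultimately show ?thesis unfolding has_derivative_at_within by simp
qed

text \<open>With a left inverse \<open>T\<close> of \<open>B (S x)\<close>, the equation at \<open>y\<close> becomes the fixed point formula
  \<open>H y = T (V y - B (S y - S x) (H y))\<close>, whose right-hand side is differentiable at \<open>x\<close> as soon as
  \<open>H\<close> is continuous there.\<close>

lemma bilinear_solution_has_derivative:
  fixes S :: "'a::euclidean_space \<Rightarrow> 'b::euclidean_space" and H :: "'a \<Rightarrow> 'c::euclidean_space"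
    and V :: "'a \<Rightarrow> 'd::euclidean_space"
  assumes B: "bounded_bilinear B" and W: "open W" "x \<in> W"
    and eq: "\<And>y. y \<in> W \<Longrightarrow> B (S y) (H y) = V y"
    and inj: "\<And>h. B (S x) h = 0 \<Longrightarrow> h = 0"
    and S: "(S has_derivative S') (at x)" and V: "(V has_derivative V') (at x)"
  obtains H' where "(H has_derivative H') (at x)"
    and "\<And>v. B (S x) (H' v) = V' v - B (S' v) (H x)"
proof -
  interpret B: bounded_bilinear B by (fact B)
  have lin: "linear (B (S x))" using B.bounded_linear_right bounded_linear.linear by blast
  have "inj (B (S x))" using inj linear_injective_0[OF lin] by blast
  then obtain T where T: "linear T" "T \<circ> B (S x) = id"
    using linear_injective_left_inverse[OF lin] by blast
  have TB: "T (B (S x) h) = h" for h using fun_cong[OF T(2), of h] by simp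
  have cont: "isCont H x"
    by (rule isCont_bilinear_solution[where S = S and V = V, OF B W eq inj])
      (use S V has_derivative_continuous in auto)
  \<comment> \<open>the derivative of the fixed point formula\<close>
  define H' where "H' = (\<lambda>v. T (V' v - B (S' v) (H x)))"
  have "((\<lambda>y. T (V y - B (S y - S x) (H y))) has_derivative H') (at x)"
    unfolding H'_def
    by (intro bounded_linear.has_derivative[OF linear_conv_bounded_linear[THEN iffD1, OF T(1)]]
        has_derivative_diff V has_derivative_bilinear_increment[OF B S cont])
  moreover have "T (V y - B (S y - S x) (H y)) = H y" if "y \<in> W" for y
    using eq[OF that] TB[of "H y"] by (simp add: B.diff_left)
  ultimately have H': "(H has_derivative H') (at x)"
    using has_derivative_transform_within_open[OF _ W] by blast
  have "((\<lambda>y. B (S y) (H y)) has_derivative (\<lambda>v. B (S x) (H' v) + B (S' v) (H x))) (at x)"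
    by (rule B.FDERIV[OF S H'])
  then have "(V has_derivative (\<lambda>v. B (S x) (H' v) + B (S' v) (H x))) (at x)"
    using has_derivative_transform_within_open[OF _ W] eq by blast
  then have "V' v = B (S x) (H' v) + B (S' v) (H x)" for v
    using has_derivative_unique[OF V] by metis
  then show ?thesis using that H' by simp
qed

text \<open>Differentiating the equation shows that each directional derivative of \<open>H\<close> solves an equation
  with the same left-hand side and a right-hand side built from \<open>H\<close> and first derivatives of the
  data. This is why the induction runs over all \<open>H\<close> and \<open>V\<close> at once.\<close>

lemma C_k_on_bilinear_solution:
  fixes S :: "'a::euclidean_space \<Rightarrow> 'b::euclidean_space" and H :: "'a \<Rightarrow> 'c::euclidean_space"
    and V :: "'a \<Rightarrow> 'd::euclidean_space"
  assumes B: "bounded_bilinear B" and W: "open W"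
    and eq: "\<And>x. x \<in> W \<Longrightarrow> B (S x) (H x) = V x"
    and inj: "\<And>x h. x \<in> W \<Longrightarrow> B (S x) h = 0 \<Longrightarrow> h = 0"
    and "C_k_on k W S" "C_k_on k W V"
  shows "C_k_on k W H"
  using assms(3,5,6)
proof (induction k arbitrary: H V)
  case 0
  then have "isCont H x" if "x \<in> W" for x
    by (intro isCont_bilinear_solution[where S = S and V = V, OF B W that 0(1) inj[OF that]])
      (use W that in \<open>auto simp: continuous_on_eq_continuous_at\<close>)
  then show ?case by (simp add: continuous_at_imp_continuous_on)
next
  case (Suc k)
  let ?S' = "\<lambda>x. frechet_derivative S (at x)" and ?V' = "\<lambda>x. frechet_derivative V (at x)"
    and ?H' = "\<lambda>x. frechet_derivative H (at x)"
  have der: "H differentiable at x \<and> (\<forall>v. B (S x) (?H' x v) = ?V' x v - B (?S' x v) (H x))"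
    if x: "x \<in> W" for x
  proof -
    obtain H' where "(H has_derivative H') (at x)" "\<And>v. B (S x) (H' v) = ?V' x v - B (?S' x v) (H x)"
      using bilinear_solution_has_derivative[where S = S and V = V, OF B W x Suc.prems(1) inj[OF x]
        C_k_on_has_derivative[OF Suc.prems(2) x] C_k_on_has_derivative[OF Suc.prems(3) x]] by blast
    then show ?thesis using frechet_derivative_at differentiableI by metis
  qed
  have SV: "C_k_on k W S" "C_k_on k W V"
    using C_k_on_pred[OF Suc.prems(2)] C_k_on_pred[OF Suc.prems(3)] .
  have "C_k_on k W H" by (rule Suc.IH[OF Suc.prems(1) SV])
  then have "C_k_on k W (\<lambda>x. ?V' x v - B (?S' x v) (H x))" for v
    using Suc.prems by (intro C_k_on_diff[OF W] C_k_on_bilinear[OF B W]) auto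
  then have "C_k_on k W (\<lambda>x. ?H' x v)" for v
    using der by (intro Suc.IH[of _ "\<lambda>x. ?V' x v - B (?S' x v) (H x)"] SV) auto
  then show ?case using der by simp
qed

section \<open>Smoothness of the matrix exponential\<close>

text \<open>The \<open>length vs\<close>-th derivative of \<open>A \<mapsto> A\<^sup>m\<close> in the directions \<open>vs\<close>. By the Leibniz rule for
  \<open>A A\<^sup>m\<close>, at most one of the directions falls on the first factor.\<close>

primrec mat_power_deriv :: "nat \<Rightarrow> (real^'k::finite^'k) list \<Rightarrow> real^'k^'k \<Rightarrow> real^'k^'k" where
  "mat_power_deriv 0 vs A = (if vs = [] then mat 1 else 0)"
| "mat_power_deriv (Suc m) vs A = A ** mat_power_deriv m vs A
     + (\<Sum>i<length vs. vs ! i ** mat_power_deriv m (take i vs @ drop (Suc i) vs) A)"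

lemma mat_power_deriv_Nil: "mat_power_deriv m [] A = mat_power A m"
  by (induction m) auto

lemma mat_power_deriv_has_derivative:
  "(mat_power_deriv m vs has_derivative (\<lambda>w. mat_power_deriv m (w # vs) A)) (at A)"
proof (induction m arbitrary: vs)
  case 0
  then show ?case by simp
next
  case (Suc m)
  have "((\<lambda>A. A ** mat_power_deriv m vs A
      + (\<Sum>i<length vs. vs ! i ** mat_power_deriv m (take i vs @ drop (Suc i) vs) A)) has_derivative
    (\<lambda>w. (A ** mat_power_deriv m (w # vs) A + w ** mat_power_deriv m vs A)
      + (\<Sum>i<length vs. vs ! i ** mat_power_deriv m (w # take i vs @ drop (Suc i) vs) A))) (at A)"
    by (intro has_derivative_add has_derivative_sum matrix_mult_has_derivative has_derivative_ident Suc.IH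
        bounded_linear.has_derivative[OF bounded_bilinear.bounded_linear_right[OF bounded_bilinear_matrix_mult]])
  moreover have "(\<lambda>w. (A ** mat_power_deriv m (w # vs) A + w ** mat_power_deriv m vs A)
      + (\<Sum>i<length vs. vs ! i ** mat_power_deriv m (w # take i vs @ drop (Suc i) vs) A))
     = (\<lambda>w. mat_power_deriv (Suc m) (w # vs) A)"
    by (simp add: sum.lessThan_Suc_shift add.assoc del: sum.lessThan_Suc)
  ultimately show ?case by simp
qed

text \<open>The recursion has a solution of the shape \<open>j! P C\<^sup>m\<close>: passing from \<open>m\<close> to \<open>m + 1\<close> costs a factor
  \<open>K R\<close> in the first summand, and \<open>K\<close> in the second, where the \<open>j\<close> terms each carry \<open>(j - 1)!\<close>.
  The bound is linear in every direction, which the series argument needs.\<close>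

lemma norm_mat_power_deriv_le:
  fixes A :: "real^'k::finite^'k"
  assumes K: "K > 0" "\<And>(A :: real^'k^'k) (B :: real^'k^'k). norm (A ** B) \<le> norm A * norm B * K" and A: "norm A \<le> R"
  shows "norm (mat_power_deriv m vs A)
    \<le> fact (length vs) * prod_list (map norm vs) * (K * (R + 1)) ^ m * norm (mat 1 :: real^'k^'k)"
proof (induction m arbitrary: vs)
  case 0
  have "0 \<le> prod_list (map norm vs)" by (intro prod_list_nonneg) auto
  then show ?case by auto
next
  case (Suc m)
  let ?N = "norm (mat 1 :: real^'k^'k)" and ?C = "K * (R + 1)" and ?P = "prod_list (map norm vs)"
  have R: "0 \<le> R" using A norm_ge_zero order_trans by blast
  have P: "0 \<le> ?P" by (intro prod_list_nonneg) auto
  let ?b = "fact (length vs) * ?P * ?C ^ m * ?N"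
  have b: "0 \<le> ?b" using P R K by auto
  have 1: "norm (A ** mat_power_deriv m vs A) \<le> R * ?b * K"
    using K(2)[of A "mat_power_deriv m vs A"] mult_mono[OF A Suc.IH[of vs] R norm_ge_zero] K(1)
    by (meson mult_right_mono less_imp_le order_trans)
  have 2: "norm (\<Sum>i<length vs. vs ! i ** mat_power_deriv m (take i vs @ drop (Suc i) vs) A) \<le> ?b * K"
  proof (cases "vs = []")
    case True
    then show ?thesis using b K by simp
  next
    case False
    then obtain l where l: "length vs = Suc l" by (cases vs) auto
    have "norm (vs ! i ** mat_power_deriv m (take i vs @ drop (Suc i) vs) A) \<le> fact l * ?P * ?C ^ m * ?N * K"
      if i: "i < length vs" for i
    proof -
      let ?us = "take i vs @ drop (Suc i) vs"
      have len: "length ?us = l" using i l by simp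
      have "?P = prod_list (map norm (take i vs @ vs ! i # drop (Suc i) vs))"
        using id_take_nth_drop[OF i] by simp
      then have P': "?P = norm (vs ! i) * prod_list (map norm ?us)" by simp
      have "norm (vs ! i) * norm (mat_power_deriv m ?us A) * K
          \<le> norm (vs ! i) * (fact l * prod_list (map norm ?us) * ?C ^ m * ?N) * K"
        using Suc.IH[of ?us] len K(1) by (intro mult_right_mono mult_left_mono) auto
      then show ?thesis using K(2)[of "vs ! i" "mat_power_deriv m ?us A"] P' by (simp add: ac_simps)
    qed
    then have "norm (\<Sum>i<length vs. vs ! i ** mat_power_deriv m (take i vs @ drop (Suc i) vs) A)
        \<le> (\<Sum>i<length vs. fact l * ?P * ?C ^ m * ?N * K)"
      by (intro sum_norm_le) auto
    then show ?thesis by (simp add: l ac_simps)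
  qed
  have "norm (mat_power_deriv (Suc m) vs A) \<le> R * ?b * K + ?b * K"
    using 1 2 norm_triangle_le[OF add_mono[OF 1 2]] by simp
  then show ?case by (simp add: algebra_simps)
qed

definition mat_exp_deriv :: "(real^'k::finite^'k) list \<Rightarrow> real^'k^'k \<Rightarrow> real^'k^'k" where
  "mat_exp_deriv vs A = (\<Sum>m. (1 / fact m) *\<^sub>R mat_power_deriv m vs A)"

lemma mat_exp_deriv_Nil: "mat_exp_deriv [] = mat_exp"
  by (simp add: fun_eq_iff mat_exp_deriv_def mat_exp_def mat_power_deriv_Nil)

text \<open>One sequence that dominates both the series for \<open>vs\<close> and, up to the factor \<open>norm w\<close>, the series for
  an additional direction \<open>w\<close>.\<close>

lemma mat_exp_deriv_majorant:
  fixes vs :: "(real^'k::finite^'k) list"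
  obtains M where "summable M"
    and "\<And>m w A. norm A \<le> R \<Longrightarrow> norm ((1 / fact m) *\<^sub>R mat_power_deriv m (w # vs) A) \<le> norm w * M m"
    and "\<And>m A. norm A \<le> R \<Longrightarrow> norm ((1 / fact m) *\<^sub>R mat_power_deriv m vs A) \<le> M m"
proof -
  obtain K where K: "K > 0" "\<And>(A :: real^'k^'k) (B :: real^'k^'k). norm (A ** B) \<le> norm A * norm B * K"
    using bounded_bilinear.pos_bounded[OF bounded_bilinear_matrix_mult[where 'a='k and 'b='k and 'c='k]]
    by (elim exE conjE) (rule that, assumption, drule spec, drule spec, assumption)
  let ?c = "\<lambda>n. fact n * prod_list (map norm vs) * norm (mat 1 :: real^'k^'k)"
  let ?C = "K * (R + 1)" and ?L = "length vs"
  define M where "M m = (?c ?L + ?c (Suc ?L)) * (inverse (fact m) * ?C ^ m)" for m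
  have P: "0 \<le> prod_list (map norm vs)" by (intro prod_list_nonneg) auto
  show thesis
  proof
    show "summable M" unfolding M_def by (intro summable_mult summable_exp)
  next
    fix m and w A :: "real^'k^'k" assume A: "norm A \<le> R"
    then have R: "0 \<le> R" using norm_ge_zero order_trans by blast
    have "norm ((1 / fact m) *\<^sub>R mat_power_deriv m (w # vs) A)
        \<le> inverse (fact m) * (norm w * (?c (Suc ?L) * ?C ^ m))"
      using norm_mat_power_deriv_le[OF K A, of m "w # vs"]
      by (simp add: divide_inverse mult_left_mono ac_simps)
    also have "\<dots> \<le> inverse (fact m) * (norm w * ((?c ?L + ?c (Suc ?L)) * ?C ^ m))"
      using P R K by (intro mult_left_mono mult_right_mono) auto
    finally show "norm ((1 / fact m) *\<^sub>R mat_power_deriv m (w # vs) A) \<le> norm w * M m"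
      by (simp add: M_def ac_simps)
  next
    fix m and A :: "real^'k^'k" assume A: "norm A \<le> R"
    then have R: "0 \<le> R" using norm_ge_zero order_trans by blast
    have "norm ((1 / fact m) *\<^sub>R mat_power_deriv m vs A) \<le> inverse (fact m) * (?c ?L * ?C ^ m)"
      using norm_mat_power_deriv_le[OF K A, of m vs]
      by (simp add: divide_inverse mult_left_mono ac_simps)
    also have "\<dots> \<le> inverse (fact m) * ((?c ?L + ?c (Suc ?L)) * ?C ^ m)"
      using P R K by (intro mult_left_mono mult_right_mono) auto
    finally show "norm ((1 / fact m) *\<^sub>R mat_power_deriv m vs A) \<le> M m"
      by (simp add: M_def ac_simps)
  qed
qed

lemma summable_mat_exp_deriv: "summable (\<lambda>m. (1 / fact m) *\<^sub>R mat_power_deriv m vs A)"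
proof -
  obtain M where M: "summable M" "\<And>m B. norm B \<le> norm A \<Longrightarrow>
      norm ((1 / fact m) *\<^sub>R mat_power_deriv m vs B) \<le> M m"
    by (rule mat_exp_deriv_majorant[of "norm A" vs], rule that)
  show ?thesis by (rule summable_comparison_test'[OF M(1)], rule M(2), rule order_refl)
qed

text \<open>Termwise differentiation; the tails of the differentiated series are at most \<open>norm h\<close> times the
  tails of the majorant, uniformly on a ball.\<close>

lemma mat_exp_deriv_has_derivative:
  "(mat_exp_deriv vs has_derivative (\<lambda>w. mat_exp_deriv (w # vs) A)) (at A)"
proof -
  let ?S = "ball 0 (norm A + 1)"
  let ?f = "\<lambda>m vs A. (1 / fact m) *\<^sub>R mat_power_deriv m vs A"
  obtain M where M: "summable M" "\<And>m w B. norm B \<le> norm A + 1 \<Longrightarrow> norm (?f m (w # vs) B) \<le> norm w * M m"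
    by (rule mat_exp_deriv_majorant[of "norm A + 1" vs], rule that)
  have "\<exists>g. \<forall>x\<in>?S. (\<lambda>m. ?f m vs x) sums g x \<and>
      (g has_derivative (\<lambda>w. mat_exp_deriv (w # vs) x)) (at x within ?S)"
  proof (rule has_derivative_series)
    show "((\<lambda>A. ?f m vs A) has_derivative (\<lambda>w. ?f m (w # vs) x)) (at x within ?S)" for m x
      by (rule bounded_linear.has_derivative[OF bounded_linear_scaleR_right
          has_derivative_at_withinI[OF mat_power_deriv_has_derivative]])
  next
    fix e :: real assume "e > 0"
    then obtain N where N: "\<And>n. n \<ge> N \<Longrightarrow> norm (\<Sum>i. M (i + n)) < e"
      using suminf_exist_split[OF \<open>e > 0\<close> M(1)] by (elim exE) (rule that, drule spec, drule mp, assumption+)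
    have "norm ((\<Sum>i<n. ?f i (h # vs) x) - mat_exp_deriv (h # vs) x) \<le> e * norm h"
      if "n \<ge> N" "x \<in> ?S" for n x h
    proof -
      have x: "norm x \<le> norm A + 1" using that by simp
      have "mat_exp_deriv (h # vs) x - (\<Sum>i<n. ?f i (h # vs) x) = (\<Sum>i. ?f (i + n) (h # vs) x)"
        unfolding mat_exp_deriv_def
        by (rule suminf_minus_initial_segment[OF summable_mat_exp_deriv, symmetric])
      moreover have "norm (\<Sum>i. ?f (i + n) (h # vs) x) \<le> (\<Sum>i. norm h * M (i + n))"
        using M x by (intro norm_suminf_le summable_mult summable_ignore_initial_segment) auto
      moreover have "(\<Sum>i. norm h * M (i + n)) = norm h * (\<Sum>i. M (i + n))"
        using M by (intro suminf_mult summable_ignore_initial_segment)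
      moreover have "norm h * (\<Sum>i. M (i + n)) \<le> norm h * e"
        using N[OF that(1)] by (intro mult_left_mono) auto
      ultimately show ?thesis by (simp add: norm_minus_commute mult.commute)
    qed
    then show "\<forall>\<^sub>F n in sequentially. \<forall>x\<in>?S. \<forall>h.
        norm ((\<Sum>i<n. ?f i (h # vs) x) - mat_exp_deriv (h # vs) x) \<le> e * norm h"
      unfolding eventually_sequentially by (intro exI[of _ N] allI impI ballI)
  next
    show "(\<lambda>m. ?f m vs A) sums mat_exp_deriv vs A"
      unfolding mat_exp_deriv_def using summable_mat_exp_deriv by (rule summable_sums)
  qed auto
  then obtain g where g: "\<And>x. x \<in> ?S \<Longrightarrow> (\<lambda>m. ?f m vs x) sums g x"
      "\<And>x. x \<in> ?S \<Longrightarrow> (g has_derivative (\<lambda>w. mat_exp_deriv (w # vs) x)) (at x within ?S)"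
    by blast
  have "A \<in> ?S" by simp
  moreover have "(g has_derivative (\<lambda>w. mat_exp_deriv (w # vs) A)) (at A)"
    using g(2)[of A] at_within_open[of A ?S] by simp
  moreover have "g x = mat_exp_deriv vs x" if "x \<in> ?S" for x
    unfolding mat_exp_deriv_def using sums_unique[OF g(1)[OF that]] .
  ultimately show ?thesis
    using has_derivative_transform_within_open[of g _ A UNIV ?S] by simp
qed

text \<open>The derivative of a member of the family \<open>mat_exp_deriv vs\<close> is again a member, so all of them are
  \<open>C\<^sup>k\<close> by one induction on \<open>k\<close>.\<close>

lemma C_k_on_mat_exp: "C_k_on k UNIV (mat_exp :: real^'k::finite^'k \<Rightarrow> _)"
proof -
  have "C_k_on k UNIV (mat_exp_deriv vs)" for vs :: "(real^'k::finite^'k) list"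
  proof (induction k arbitrary: vs)
    case 0
    then show ?case
      using mat_exp_deriv_has_derivative has_derivative_continuous
      by (auto intro!: continuous_at_imp_continuous_on) blast
  next
    case (Suc k)
    then show ?case by (rule C_k_on_SucI[OF open_UNIV mat_exp_deriv_has_derivative])
  qed
  then show ?thesis using mat_exp_deriv_Nil by metis
qed

lemma mat_exp_0: "mat_exp (0 :: real^'k::finite^'k) = mat 1"
proof -
  have "mat_power (0 :: real^'k^'k) m = 0" if "m \<noteq> 0" for m
    using that by (cases m) (auto simp: matrix_matrix_mult_def vec_eq_iff)
  then show ?thesis unfolding mat_exp_def by (subst suminf_finite[of "{0}"]) auto
qed

lemma mat_exp_has_derivative_0: "(mat_exp has_derivative (\<lambda>w :: real^'k::finite^'k. w)) (at 0)"
proof -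
  have "mat_power_deriv m [w] 0 = (if m = 1 then w else 0)" for m and w :: "real^'k^'k"
  proof (cases m)
    case (Suc l)
    then show ?thesis by (cases l) (auto simp: mat_power_deriv_Nil)
  qed simp
  then have "mat_exp_deriv [w] 0 = w" for w :: "real^'k^'k"
    unfolding mat_exp_deriv_def by (subst suminf_finite[of "{1}"]) auto
  then show ?thesis
    using mat_exp_deriv_has_derivative[of "[]" "0 :: real^'k^'k"] by (simp add: mat_exp_deriv_Nil)
qed

text \<open>If \<open>H\<close> commutes with \<open>A\<close>, the derivative of \<open>A\<^sup>m\<close> collapses to \<open>m H A\<^sup>m\<^sup>-\<^sup>1\<close>, as for scalars.\<close>

lemma mat_exp_deriv_commuting:
  fixes A H :: "real^'k::finite^'k"
  assumes "A ** H = H ** A"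
  shows "mat_exp_deriv [H] A = H ** mat_exp A"
proof -
  interpret B: bounded_bilinear "(**) :: real^'k^'k \<Rightarrow> real^'k^'k \<Rightarrow> real^'k^'k"
    by (rule bounded_bilinear_matrix_mult)
  have D: "mat_power_deriv (Suc m) [H] A = real (Suc m) *\<^sub>R (H ** mat_power A m)" for m
  proof (induction m)
    case 0
    then show ?case by simp
  next
    case (Suc m)
    have "mat_power_deriv (Suc (Suc m)) [H] A = A ** (real (Suc m) *\<^sub>R (H ** mat_power A m)) + H ** mat_power A (Suc m)"
      using Suc.IH by (simp add: mat_power_deriv_Nil)
    also have "A ** (real (Suc m) *\<^sub>R (H ** mat_power A m)) = real (Suc m) *\<^sub>R (H ** mat_power A (Suc m))"
      using assms by (simp add: B.scaleR_right matrix_mul_assoc)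
    also have "real (Suc m) *\<^sub>R (H ** mat_power A (Suc m)) + H ** mat_power A (Suc m)
        = (real (Suc m) + 1) *\<^sub>R (H ** mat_power A (Suc m))"
      by (simp only: scaleR_add_left scaleR_one)
    finally show ?case by (simp only: of_nat_Suc add.commute)
  qed
  have "mat_exp_deriv [H] A = (\<Sum>m. (1 / fact (Suc m)) *\<^sub>R mat_power_deriv (Suc m) [H] A)"
    unfolding mat_exp_deriv_def using suminf_split_head[OF summable_mat_exp_deriv, of "[H]" A] by simp
  also have "\<dots> = (\<Sum>m. (1 / fact m) *\<^sub>R (H ** mat_power A m))"
  proof -
    have "(1 / fact (Suc m)) *\<^sub>R mat_power_deriv (Suc m) [H] A = (1 / fact m) *\<^sub>R (H ** mat_power A m)" for m
      unfolding D scaleR_scaleR by (simp add: divide_simps del: of_nat_Suc)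
    then show ?thesis by simp
  qed
  also have "\<dots> = (\<Sum>m. H ** ((1 / fact m) *\<^sub>R mat_power A m))" by (simp add: B.scaleR_right)
  also have "\<dots> = H ** mat_exp A"
    unfolding mat_exp_def
    using bounded_linear.suminf[OF B.bounded_linear_right[of H] summable_mat_exp_deriv[of "[]" A]]
    by (simp add: mat_power_deriv_Nil)
  finally show ?thesis .
qed

lemma mat_exp_curve_has_derivative:
  fixes H :: "real^'k::finite^'k"
  shows "((\<lambda>t. mat_exp (t *\<^sub>R H)) has_derivative (\<lambda>s. s *\<^sub>R (H ** mat_exp (t *\<^sub>R H)))) (at t)"
proof -
  interpret B: bounded_bilinear "(**) :: real^'k^'k \<Rightarrow> real^'k^'k \<Rightarrow> real^'k^'k"
    by (rule bounded_bilinear_matrix_mult)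
  have lin: "linear (\<lambda>w. mat_exp_deriv [w] (t *\<^sub>R H))"
    using mat_exp_deriv_has_derivative[of "[]"] has_derivative_linear by blast
  have "((\<lambda>t. mat_exp_deriv [] (t *\<^sub>R H)) has_derivative (\<lambda>s. mat_exp_deriv [s *\<^sub>R H] (t *\<^sub>R H))) (at t)"
    by (rule has_derivative_compose[OF _ mat_exp_deriv_has_derivative])
      (rule bounded_linear_imp_has_derivative[OF bounded_linear_scaleR_left])
  moreover have "mat_exp_deriv [s *\<^sub>R H] (t *\<^sub>R H) = s *\<^sub>R (H ** mat_exp (t *\<^sub>R H))" for s
    using linear_cmul[OF lin, of s H] mat_exp_deriv_commuting[of "t *\<^sub>R H" H]
    by (simp add: B.scaleR_left B.scaleR_right)
  ultimately show ?thesis by (simp add: mat_exp_deriv_Nil)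
qed

section \<open>Polynomials in a complex matrix and its spectrum\<close>

lemma mat_scalar_left_nth: "(mat c ** A) $ i $ j = c * (A :: 'a::comm_semiring_1^'n::finite^'m::finite) $ i $ j"
  by (simp add: matrix_matrix_mult_def mat_def if_distrib if_distribR cong: if_cong)

lemma mat_scalar_commute: "mat c ** A = A ** mat (c :: 'a::comm_semiring_1)"
  by (simp add: matrix_matrix_mult_def mat_def vec_eq_iff if_distrib if_distribR mult.commute cong: if_cong)

lemma mat_scalar_vector: "mat c *v v = c *s (v :: 'a::comm_semiring_1^'n::finite)"
  by (simp add: matrix_vector_mult_def mat_def vec_eq_iff if_distrib if_distribR cong: if_cong)

lemma mat_add: "mat (a + b) = (mat a :: 'a::semiring_1^'n::finite^'n) + mat b"
  by (simp add: mat_def vec_eq_iff)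

lemma mat_diff: "mat (a - b) = (mat a :: 'a::ring_1^'n::finite^'n) - mat b"
  by (simp add: mat_def vec_eq_iff)

text \<open>Evaluation at a matrix. The class product on matrices is componentwise, so \<open>poly\<close> does not apply;
  scalars enter as \<open>mat c\<close>.\<close>

definition poly_mat :: "complex poly \<Rightarrow> complex^'k::finite^'k \<Rightarrow> complex^'k^'k" where
  "poly_mat p A = fold_coeffs (\<lambda>c B. mat c + A ** B) p 0"

lemma poly_mat_0 [simp]: "poly_mat 0 A = 0"
  by (simp add: poly_mat_def)

lemma poly_mat_pCons [simp]: "poly_mat (pCons c p) A = mat c + A ** poly_mat p A"
  by (cases "p = 0 \<and> c = 0") (auto simp: poly_mat_def mat_mult_zero_right)

lemma poly_mat_add: "poly_mat (p + q) A = poly_mat p A + poly_mat q A"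
  by (induction p q rule: poly_induct2) (simp_all add: mat_add matrix_add_ldistrib)

lemma poly_mat_smult: "poly_mat (smult c p) A = mat c ** poly_mat p A"
proof (induction p)
  case (pCons a p)
  have "mat (c * a) = mat c ** (mat a :: complex^'a^'a)"
    by (simp add: vec_eq_iff mat_scalar_left_nth) (simp add: mat_def)
  moreover have "A ** (mat c ** poly_mat p A) = mat c ** (A ** poly_mat p A)"
    by (simp only: matrix_mul_assoc mat_scalar_commute[of c A])
  ultimately show ?case using pCons by (simp add: matrix_add_ldistrib)
qed (simp)

lemma poly_mat_mult: "poly_mat (p * q) A = poly_mat p A ** poly_mat q A"
  by (induction p) (simp_all add: mat_mult_zero_left poly_mat_add poly_mat_smult mat_mult_add_left matrix_mul_assoc)

lemma poly_mat_sum: "poly_mat (\<Sum>i\<in>I. f i) A = (\<Sum>i\<in>I. poly_mat (f i) A)"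
  by (induction I rule: infinite_finite_induct) (simp_all add: poly_mat_add)

lemma poly_mat_diff: "poly_mat (p - q) A = poly_mat p A - poly_mat q A"
  using poly_mat_add[of "p - q" q A] by simp

lemma poly_mat_linear_factor: "poly_mat [:- z, 1:] A = A - mat z"
  using mat_diff[of 0 z] by (simp)

definition has_eigenvalue :: "complex^'k::finite^'k \<Rightarrow> complex \<Rightarrow> bool" where
  "has_eigenvalue A z \<longleftrightarrow> (\<exists>v. v \<noteq> 0 \<and> A *v v = z *s v)"

lemma poly_mat_eigenvector:
  assumes "A *v v = z *s v" shows "poly_mat p A *v v = poly p z *s v"
proof (induction p)
  case (pCons c p)
  have "A *v (poly p z *s v) = (z * poly p z) *s v"
    using assms by (simp add: vec.scale mult.commute)
  then show ?case using pCons
    by (simp add: matrix_vector_mult_add_rdistrib mat_scalar_vector matrix_vector_mul_assoc[symmetric]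
        vec.scale_left_distrib)
qed simp

lemma has_eigenvalue_iff_singular:
  "has_eigenvalue A z \<longleftrightarrow> \<not> invertible (A - mat z)"
proof -
  have "(A - mat z) *v v = 0 \<longleftrightarrow> A *v v = z *s v" for v
    by (simp add: matrix_vector_mult_diff_rdistrib mat_scalar_vector)
  then show ?thesis
    unfolding has_eigenvalue_def invertible_left_inverse matrix_left_invertible_ker by blast
qed

text \<open>Any nonzero column of \<open>Z\<close> is an eigenvector.\<close>

lemma has_eigenvalueI_left:
  assumes "(A - mat z) ** Z = 0" "Z \<noteq> 0" shows "has_eigenvalue A z"
proof (rule ccontr)
  assume "\<not> has_eigenvalue A z"
  then obtain B where "B ** (A - mat z) = mat 1"
    unfolding has_eigenvalue_iff_singular invertible_left_inverse by blast
  then have "Z = B ** ((A - mat z) ** Z)" by (simp add: matrix_mul_assoc)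
  then show False using assms by (simp)
qed

text \<open>Here the nonzero rows of \<open>Z\<close> are left eigenvectors, and a square matrix has the same left and
  right eigenvalues.\<close>

lemma has_eigenvalueI_right:
  assumes "Z ** (A - mat z) = 0" "Z \<noteq> 0" shows "has_eigenvalue A z"
proof (rule ccontr)
  assume "\<not> has_eigenvalue A z"
  then obtain B where "(A - mat z) ** B = mat 1"
    unfolding has_eigenvalue_iff_singular invertible_right_inverse by blast
  then have "Z = (Z ** (A - mat z)) ** B" by (simp add: matrix_mul_assoc[symmetric])
  then show False using assms by (simp)
qed

text \<open>The space of matrices is finite-dimensional over the reals, so sufficiently many powers of \<open>A\<close> are
  linearly dependent.\<close>

lemma exists_annihilating_poly:
  fixes A :: "complex^'k::finite^'k"
  shows "\<exists>p. p \<noteq> 0 \<and> poly_mat p A = 0"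
proof -
  \<comment> \<open>the exponents \<open>0, ..., N\<close> give one power more than the real dimension\<close>
  define N where "N = DIM(complex^'k^'k)"
  define P where "P i = poly_mat (monom 1 i) A" for i
  show ?thesis
  proof (cases "inj_on P {..N}")
    case False
    then obtain i j where ij: "i \<noteq> j" "P i = P j" unfolding inj_on_def by blast
    then have "monom 1 i - monom 1 j \<noteq> (0 :: complex poly)"
      by (metis eq_iff_diff_eq_0 monom_eq_iff' zero_neq_one)
    then show ?thesis using ij unfolding P_def
      by (intro exI[of _ "monom 1 i - monom 1 j"]) (auto simp: poly_mat_diff)
  next
    case True
    then have "card (P ` {..N}) > DIM(complex^'k^'k)" by (simp add: card_image N_def)
    then have "dependent (P ` {..N})" by (intro dependent_biggerset)
    then obtain u i where u: "i \<le> N" "u (P i) \<noteq> 0" "(\<Sum>v\<in>P ` {..N}. u v *\<^sub>R v) = 0"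
      using real_vector.dependent_finite[of "P ` {..N}"] by auto
    define p where "p = (\<Sum>i\<le>N. monom (complex_of_real (u (P i))) i)"
    have "poly_mat (monom (complex_of_real c) i) A = c *\<^sub>R P i" for c i
    proof -
      have "poly_mat (monom (complex_of_real c) i) A = mat (complex_of_real c) ** P i"
        unfolding P_def poly_mat_smult[symmetric] by (simp add: smult_monom)
      also have "\<dots> = c *\<^sub>R P i"
        by (simp add: vec_eq_iff mat_scalar_left_nth) (simp add: scaleR_conv_of_real)
      finally show ?thesis .
    qed
    then have "poly_mat p A = 0"
      using u(3) True by (simp add: p_def poly_mat_sum sum.reindex)
    moreover have "coeff p i = complex_of_real (u (P i))"
      using u(1) by (simp add: p_def coeff_sum)
    ultimately show ?thesis using u(2) by (intro exI[of _ p]) auto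
  qed
qed

text \<open>A polynomial of least degree works: splitting off a root \<open>z\<close> leaves \<open>q\<close> with \<open>q(A) \<noteq> 0\<close> and
  \<open>(A - z) q(A) = 0\<close>.\<close>

lemma exists_annihilating_poly_eigenvalues:
  fixes A :: "complex^'k::finite^'k"
  shows "\<exists>p. p \<noteq> 0 \<and> poly_mat p A = 0 \<and> (\<forall>z. poly p z = 0 \<longrightarrow> has_eigenvalue A z)"
proof -
  obtain p where p: "p \<noteq> 0" "poly_mat p A = 0"
    and least: "\<And>q. q \<noteq> 0 \<Longrightarrow> poly_mat q A = 0 \<Longrightarrow> degree p \<le> degree q"
    using ex_has_least_nat[of "\<lambda>p. p \<noteq> 0 \<and> poly_mat p A = 0" _ degree] exists_annihilating_poly[of A]
    by metis
  have "has_eigenvalue A z" if z: "poly p z = 0" for z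
  proof -
    obtain q where q: "p = [:- z, 1:] * q" using z unfolding poly_eq_0_iff_dvd by (rule dvdE)
    then have "q \<noteq> 0" using p by auto
    then have "degree p = Suc (degree q)" unfolding q by (subst degree_mult_eq) auto
    then have "poly_mat q A \<noteq> 0" using least[of q] \<open>q \<noteq> 0\<close> by auto
    moreover have "(A - mat z) ** poly_mat q A = 0"
      using p(2) unfolding q poly_mat_mult poly_mat_linear_factor .
    ultimately show ?thesis by (intro has_eigenvalueI_left)
  qed
  then show ?thesis using p by blast
qed

text \<open>For a root \<open>z\<close> of \<open>p\<close>, the matrix \<open>(X - z) Z = Z (W - z)\<close> is an intertwiner as well and is
  annihilated by a polynomial of smaller degree, so it is zero. If \<open>Z\<close> were not, \<open>z\<close> would be an
  eigenvalue of both \<open>X\<close> and \<open>W\<close>.\<close>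

lemma intertwiner_eq_0_of_annihilator:
  fixes X W Z :: "complex^'k::finite^'k"
  assumes "p \<noteq> 0" "X ** Z = Z ** W" "poly_mat p X ** Z = 0"
    and disj: "\<And>z. \<not> (has_eigenvalue X z \<and> has_eigenvalue W z)"
  shows "Z = 0"
  using assms(1-3)
proof (induction "degree p" arbitrary: p Z)
  case 0
  then obtain c where c: "p = [:c:]" "c \<noteq> 0" by (metis degree_eq_zeroE pCons_0_0)
  then have "mat c ** Z = 0" using 0(4) by (simp)
  then have "c * Z $ i $ j = 0" for i j by (metis mat_scalar_left_nth zero_index)
  then show ?case using c by (simp add: vec_eq_iff)
next
  case (Suc d)
  then obtain z where z: "poly p z = 0"
    using fundamental_theorem_of_algebra[of p] by (auto simp: constant_degree)
  obtain q where q: "p = [:- z, 1:] * q" using z unfolding poly_eq_0_iff_dvd by (rule dvdE)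
  then have "q \<noteq> 0" using Suc by auto
  then have "degree p = Suc (degree q)" unfolding q by (subst degree_mult_eq) auto
  then have deg: "d = degree q" using Suc by simp
  let ?Z = "(X - mat z) ** Z"
  have Z: "?Z = Z ** (W - mat z)"
    using Suc.prems(2) by (simp add: mat_mult_diff_left mat_mult_diff_right mat_scalar_commute)
  have "?Z = 0"
  proof (rule Suc.hyps(1)[OF deg \<open>q \<noteq> 0\<close>])
    show "X ** ?Z = ?Z ** W"
      using Suc.prems(2) unfolding Z
      by (simp add: matrix_mul_assoc mat_mult_diff_right mat_mult_diff_left)
        (simp add: matrix_mul_assoc[symmetric] mat_scalar_commute)
    have "poly_mat q X ** ?Z = poly_mat (q * [:- z, 1:]) X ** Z"
      unfolding poly_mat_mult poly_mat_linear_factor by (simp add: matrix_mul_assoc)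
    then show "poly_mat q X ** ?Z = 0" using Suc.prems(3) by (simp add: q mult.commute)
  qed
  then show "Z = 0"
    using has_eigenvalueI_left[of X z Z] has_eigenvalueI_right[of Z W z] disj[of z] Z by auto
qed

lemma intertwiner_eq_0:
  fixes X W Z :: "complex^'k::finite^'k"
  assumes "X ** Z = Z ** W" "\<And>z. \<not> (has_eigenvalue X z \<and> has_eigenvalue W z)"
  shows "Z = 0"
  using exists_annihilating_poly[of X] intertwiner_eq_0_of_annihilator[OF _ assms(1) _ assms(2)]
  by (auto simp: mat_mult_zero_left)

lemma has_eigenvalue_uminus: "has_eigenvalue (- A) z \<longleftrightarrow> has_eigenvalue A (- z)"
proof -
  have "(- A) *v v = z *s v \<longleftrightarrow> A *v v = (- z) *s v" for v
    using minus_equation_iff[of "A *v v" "z *s v"] matrix_vector_mult_diff_rdistrib[of 0 A v] by auto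
  then show ?thesis unfolding has_eigenvalue_def by simp
qed

text \<open>\<open>H\<close> intertwines \<open>X\<close> with \<open>- Y\<close>, and these have spectra on different sides of the imaginary axis.\<close>

lemma sylvester_injective:
  fixes X Y H :: "complex^'k::finite^'k"
  assumes "\<And>z. has_eigenvalue X z \<Longrightarrow> Re z > 0" "\<And>z. has_eigenvalue Y z \<Longrightarrow> Re z > 0"
    and "X ** H + H ** Y = 0"
  shows "H = 0"
proof (rule intertwiner_eq_0)
  show "X ** H = H ** (- Y)" using assms(3) by (simp add: mat_mult_minus_right add_eq_0_iff)
  show "\<not> (has_eigenvalue X z \<and> has_eigenvalue (- Y) z)" for z
    using assms(1)[of z] assms(2)[of "- z"] by (auto simp: has_eigenvalue_uminus)
qed

lemma Re_csqrt_pos: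
  assumes "z \<notin> \<real>\<^sub>\<le>\<^sub>0" shows "Re (csqrt z) > 0"
proof (rule ccontr)
  assume "\<not> Re (csqrt z) > 0"
  then have 0: "Re (csqrt z) = 0" using csqrt_principal[of z] by auto
  have "z = (csqrt z)\<^sup>2" by simp
  also have "\<dots> = complex_of_real (- (Im (csqrt z))\<^sup>2)"
    using 0 by (simp add: complex_eq_iff power2_eq_square)
  finally show False using assms by (metis neg_le_0_iff_le nonpos_Reals_of_real_iff zero_le_power2)
qed

text \<open>A square root of \<open>x\<close> modulo \<open>p\<close>, built one linear factor at a time. Suppose \<open>r\<^sup>2 - x = q t\<close> and
  \<open>p = (x - z) q\<close>. Then \<open>(r + c q)\<^sup>2 - x = q (t + 2 c r + c\<^sup>2 q)\<close> for every constant \<open>c\<close>, and \<open>c\<close> can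
  be chosen such that the second factor vanishes at \<open>z\<close>. Adding a multiple of \<open>q\<close> keeps the values at
  the roots of \<open>q\<close>.\<close>

lemma poly_sqrt_mod:
  fixes p :: "complex poly"
  assumes "p \<noteq> 0" "\<And>z. poly p z = 0 \<Longrightarrow> z \<notin> \<real>\<^sub>\<le>\<^sub>0"
  shows "\<exists>r. p dvd r\<^sup>2 - [:0, 1:] \<and> (\<forall>z. poly p z = 0 \<longrightarrow> Re (poly r z) > 0)"
  using assms
proof (induction "degree p" arbitrary: p)
  case 0
  then obtain c where "p = [:c:]" "c \<noteq> 0" by (metis degree_eq_zeroE pCons_0_0)
  moreover have "is_unit p" using 0 is_unit_iff_degree[of p] by simp
  ultimately show ?case using unit_imp_dvd[of p] by auto
next
  case (Suc d)
  then obtain z where z: "poly p z = 0"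
    using fundamental_theorem_of_algebra[of p] by (auto simp: constant_degree)
  obtain q where q: "p = [:- z, 1:] * q" using z unfolding poly_eq_0_iff_dvd by (rule dvdE)
  then have "q \<noteq> 0" using Suc by auto
  then have "degree p = Suc (degree q)" unfolding q by (subst degree_mult_eq) auto
  then have deg: "d = degree q" using Suc by simp
  have roots: "poly p w = 0 \<longleftrightarrow> w = z \<or> poly q w = 0" for w by (auto simp: q)
  obtain r where r: "q dvd r\<^sup>2 - [:0, 1:]" "\<And>w. poly q w = 0 \<Longrightarrow> Re (poly r w) > 0"
    using Suc.hyps(1)[OF deg \<open>q \<noteq> 0\<close>] Suc.prems(2) roots by blast
  then obtain t where t: "r\<^sup>2 - [:0, 1:] = q * t" by blast
  have "\<exists>c. poly (t + smult (2 * c) r + smult (c\<^sup>2) q) z = 0 \<and> Re (poly (r + smult c q) z) > 0"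
  proof (cases "poly q z = 0")
    case True
    \<comment> \<open>a repeated root: the value there is kept, and the condition on \<open>c\<close> is linear\<close>
    then have "Re (poly r z) > 0" using r by blast
    then show ?thesis using True
      by (intro exI[of _ "- poly t z / (2 * poly r z)"]) (auto simp: field_simps)
  next
    case False
    \<comment> \<open>prescribe the value \<open>csqrt z\<close> at the new root; its square is \<open>z\<close>\<close>
    define c where "c = (csqrt z - poly r z) / poly q z"
    have c: "poly r z + c * poly q z = csqrt z" using False by (simp add: c_def)
    have tz: "(poly r z)\<^sup>2 - z = poly q z * poly t z"
      using arg_cong[OF t, of "\<lambda>p. poly p z"] by (simp add: power2_eq_square)
    have "poly q z * poly (t + smult (2 * c) r + smult (c\<^sup>2) q) z = (poly r z + c * poly q z)\<^sup>2 - z"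
      using tz by (simp add: power2_eq_square algebra_simps)
    also have "\<dots> = 0" unfolding c by simp
    finally show ?thesis
      using False c Re_csqrt_pos[of z] Suc.prems(2)[OF z] by (intro exI[of _ c]) auto
  qed
  then obtain c where c: "poly (t + smult (2 * c) r + smult (c\<^sup>2) q) z = 0" "Re (poly (r + smult c q) z) > 0"
    by blast
  have "smult (2 * c) r = 2 * smult c r" by (simp only: mult_2 smult_add_left)
  then have "(r + smult c q)\<^sup>2 - [:0, 1:] = (r\<^sup>2 - [:0, 1:]) + q * (smult (2 * c) r + smult (c\<^sup>2) q)"
    by (simp add: power2_eq_square algebra_simps)
  also have "\<dots> = q * (t + smult (2 * c) r + smult (c\<^sup>2) q)" unfolding t by (simp add: algebra_simps)
  finally have eq: "(r + smult c q)\<^sup>2 - [:0, 1:] = q * (t + smult (2 * c) r + smult (c\<^sup>2) q)" .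
  have "p dvd (r + smult c q)\<^sup>2 - [:0, 1:]"
    unfolding eq q using c(1)[unfolded poly_eq_0_iff_dvd]
    by (subst mult.commute) (rule mult_dvd_mono[OF dvd_refl])
  moreover have "Re (poly (r + smult c q) w) > 0" if "poly p w = 0" for w
    using that c(2) r(2)[of w] unfolding roots by auto
  ultimately show ?case by blast
qed

text \<open>An eigenvector \<open>v\<close> of the root \<open>r(A)\<close> for \<open>z\<close> is an eigenvector of \<open>A = r(A)\<^sup>2\<close> for \<open>z\<^sup>2\<close>, hence
  \<open>z = r(z\<^sup>2)\<close> with \<open>z\<^sup>2\<close> a root of the annihilating polynomial.\<close>

lemma complex_matrix_sqrt_exists:
  fixes A :: "complex^'k::finite^'k"
  assumes "\<And>z. has_eigenvalue A z \<Longrightarrow> z \<notin> \<real>\<^sub>\<le>\<^sub>0"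
  shows "\<exists>X. X ** X = A \<and> (\<forall>z. has_eigenvalue X z \<longrightarrow> Re z > 0)"
proof -
  obtain p where p: "p \<noteq> 0" "poly_mat p A = 0" "\<And>z. poly p z = 0 \<Longrightarrow> has_eigenvalue A z"
    using exists_annihilating_poly_eigenvalues by blast
  then obtain r where r: "p dvd r\<^sup>2 - [:0, 1:]" "\<And>z. poly p z = 0 \<Longrightarrow> Re (poly r z) > 0"
    using poly_sqrt_mod assms by metis
  then obtain t where "r * r = [:0, 1:] + p * t" unfolding power2_eq_square
    by (metis dvdE add_diff_cancel_left' diff_eq_eq add.commute)
  then have sq: "poly_mat r A ** poly_mat r A = A"
    unfolding poly_mat_mult[symmetric] using p(2)
    by (simp add: poly_mat_add poly_mat_mult)
  have "Re z > 0" if ev: "has_eigenvalue (poly_mat r A) z" for z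
  proof -
    obtain v where v: "v \<noteq> 0" "poly_mat r A *v v = z *s v" using ev unfolding has_eigenvalue_def by blast
    have "A *v v = poly_mat r A *v (poly_mat r A *v v)" by (simp add: matrix_vector_mul_assoc sq)
    then have Av: "A *v v = (z * z) *s v" using v by (simp add: vec.scale)
    have "poly p (z * z) *s v = 0" using poly_mat_eigenvector[OF Av, of p] p by simp
    then have "poly p (z * z) = 0" using v by simp
    moreover have "poly r (z * z) *s v = z *s v" using poly_mat_eigenvector[OF Av, of r] v by simp
    then have "poly r (z * z) = z" using v by simp
    ultimately show ?thesis using r(2) by metis
  qed
  then show ?thesis using sq by blast
qed

text \<open>\<open>X (X - Y) + (X - Y) Y = X\<^sup>2 - Y\<^sup>2\<close>, whether or not \<open>X\<close> and \<open>Y\<close> commute.\<close>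

lemma matrix_sqrt_unique_complex:
  fixes X Y :: "complex^'k::finite^'k"
  assumes "X ** X = Y ** Y" "\<And>z. has_eigenvalue X z \<Longrightarrow> Re z > 0" "\<And>z. has_eigenvalue Y z \<Longrightarrow> Re z > 0"
  shows "X = Y"
proof -
  have "X ** (X - Y) + (X - Y) ** Y = 0" using assms(1) by (simp add: mat_mult_diff_left mat_mult_diff_right)
  then have "X - Y = 0" using sylvester_injective[OF assms(2,3)] by blast
  then show ?thesis by simp
qed

section \<open>The principal square root of a real matrix\<close>

abbreviation cmat :: "real^'n::finite^'m::finite \<Rightarrow> complex^'n^'m" where
  "cmat \<equiv> map_matrix complex_of_real"

lemma cmat_mult: "cmat (A ** B) = cmat A ** cmat B"
  by (simp add: vec_eq_iff matrix_matrix_mult_def)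

lemma cmat_add: "cmat (A + B) = cmat A + cmat B"
  by (simp add: vec_eq_iff)

lemma cmat_0: "cmat 0 = 0"
  by (simp add: vec_eq_iff)

lemma cmat_mat: "cmat (mat c) = mat (complex_of_real c)"
  by (simp add: vec_eq_iff mat_def)

lemma cmat_transpose: "cmat (transpose A) = transpose (cmat A)"
  by (simp add: vec_eq_iff transpose_def)

lemma cmat_eq_iff: "cmat A = cmat B \<longleftrightarrow> A = B"
  by (simp add: vec_eq_iff)

lemma complex_eigenvalue_iff: "complex_eigenvalue A z \<longleftrightarrow> has_eigenvalue (cmat A) z"
  by (simp add: complex_eigenvalue_def has_eigenvalue_def)

lemma complex_eigenvalue_transpose: "complex_eigenvalue (transpose A) z \<longleftrightarrow> complex_eigenvalue A z"
proof -
  have "transpose (cmat A) - mat z = transpose (cmat A - mat z)"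
    by (simp add: vec_eq_iff transpose_def mat_def)
  then have "invertible (transpose (cmat A) - mat z) \<longleftrightarrow> invertible (cmat A - mat z)"
    unfolding invertible_right_inverse[of "transpose (cmat A) - mat z"] invertible_left_inverse[of "cmat A - mat z"]
    by (simp add: right_invertible_transpose)
  then show ?thesis
    by (simp add: complex_eigenvalue_iff has_eigenvalue_iff_singular cmat_transpose)
qed

lemma complex_eigenvalue_similar:
  fixes S X Y :: "real^'k::finite^'k"
  assumes "S ** X = Y ** S" "invertible S" "complex_eigenvalue X z"
  shows "complex_eigenvalue Y z"
proof -
  obtain v where v: "v \<noteq> 0" "cmat X *v v = z *s v" using assms(3) complex_eigenvalue_def by blast
  obtain T where "T ** S = mat 1" using assms(2) invertible_def by metis
  then have "cmat T ** cmat S = mat 1" using cmat_mult[of T S] by (simp add: cmat_mat)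
  then have "cmat S *v v \<noteq> 0" using v(1)
    by (metis matrix_vector_mul_assoc matrix_vector_mul_lid matrix_vector_mult_0_right)
  moreover have "cmat Y *v (cmat S *v v) = z *s (cmat S *v v)"
    using v(2) assms(1) cmat_mult[of S X] cmat_mult[of Y S]
    by (simp add: matrix_vector_mul_assoc vec.scale[symmetric])
       (simp add: matrix_vector_mul_assoc[symmetric])
  ultimately show ?thesis unfolding complex_eigenvalue_def by blast
qed

definition right_half_spectrum :: "real^'k::finite^'k \<Rightarrow> bool" where
  "right_half_spectrum X \<longleftrightarrow> (\<forall>z. complex_eigenvalue X z \<longrightarrow> Re z > 0)"

lemma principal_sqrt_unique:
  assumes "X ** X = Y ** Y" "right_half_spectrum X" "right_half_spectrum Y"
  shows "X = Y"
proof -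
  have "cmat X = cmat Y"
  proof (rule matrix_sqrt_unique_complex)
    show "cmat X ** cmat X = cmat Y ** cmat Y" using assms(1) by (metis cmat_mult)
  qed (use assms in \<open>simp_all add: right_half_spectrum_def complex_eigenvalue_iff\<close>)
  then show ?thesis by (simp add: cmat_eq_iff)
qed

lemma principal_sqrt_eqI:
  assumes "X ** X = A" "right_half_spectrum X" shows "principal_sqrt A = X"
  unfolding principal_sqrt_def
  using assms principal_sqrt_unique by (intro the_equality) (auto simp: right_half_spectrum_def)

text \<open>The entrywise conjugate of the complex root is a root with spectrum in the right half-plane, too, so
  by uniqueness the complex root is real.\<close>

lemma real_principal_sqrt_exists:
  assumes "no_nonpos_eigenvalue A"
  shows "\<exists>X. X ** X = A \<and> right_half_spectrum X"
proof -
  obtain X where X: "X ** X = cmat A" "\<And>z. has_eigenvalue X z \<Longrightarrow> Re z > 0"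
    using complex_matrix_sqrt_exists[of "cmat A"] assms
    unfolding no_nonpos_eigenvalue_def complex_eigenvalue_iff by blast
  \<comment> \<open>the conjugate of an eigenvector of \<open>?c X\<close> for \<open>z\<close> is an eigenvector of \<open>X\<close> for \<open>cnj z\<close>\<close>
  let ?c = "map_matrix cnj :: complex^'a^'a \<Rightarrow> _"
  have cmult: "?c (B ** C) = ?c B ** ?c C" for B C
    by (simp add: vec_eq_iff matrix_matrix_mult_def)
  have ev: "Re z > 0" if z: "has_eigenvalue (?c X) z" for z
  proof -
    obtain v where v: "v \<noteq> 0" "?c X *v v = z *s v" using z unfolding has_eigenvalue_def by blast
    let ?w = "\<chi> i. cnj (v $ i)"
    have "?w \<noteq> 0" using v(1) by (simp add: vec_eq_iff)
    moreover have "X *v ?w = cnj z *s ?w"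
    proof -
      have "cnj ((?c X *v v) $ i) = cnj ((z *s v) $ i)" for i using v(2) by simp
      then show ?thesis by (simp add: vec_eq_iff matrix_vector_mult_def)
    qed
    ultimately have "has_eigenvalue X (cnj z)" unfolding has_eigenvalue_def by blast
    then show ?thesis using X(2) by fastforce
  qed
  have "?c X ** ?c X = X ** X"
    using X(1) cmult[of X X] by (simp add: vec_eq_iff)
  then have "?c X = X" using matrix_sqrt_unique_complex ev X(2) by blast
  then have "cnj (X $ i $ j) = X $ i $ j" for i j by (metis nth_map_matrix)
  then have "X = cmat (map_matrix Re X)"
    by (simp add: vec_eq_iff complex_eq_iff)
  then obtain Y where Y: "X = cmat Y" by blast
  then have "Y ** Y = A" using X(1) by (metis cmat_eq_iff cmat_mult)
  then show ?thesis using X(2) Y unfolding right_half_spectrum_def complex_eigenvalue_iff by blast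
qed

lemma principal_sqrt:
  assumes "no_nonpos_eigenvalue A"
  shows "principal_sqrt A ** principal_sqrt A = A" "right_half_spectrum (principal_sqrt A)"
proof -
  obtain X where X: "X ** X = A" "right_half_spectrum X" using real_principal_sqrt_exists[OF assms] by blast
  then have "principal_sqrt A = X" by (rule principal_sqrt_eqI)
  then show "principal_sqrt A ** principal_sqrt A = A" "right_half_spectrum (principal_sqrt A)"
    using X by auto
qed

lemma bounded_bilinear_matrix_vector_mult:
  "bounded_bilinear ((*v) :: complex^'n::finite^'m::finite \<Rightarrow> complex^'n \<Rightarrow> complex^'m)"
  unfolding bilinear_conv_bounded_bilinear[symmetric]
  by (auto simp: bilinear_def linear_iff matrix_vector_mult_def vec_eq_iff sum.distrib
      algebra_simps scaleR_sum_right)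

lemma bounded_bilinear_vec_scale:
  "bounded_bilinear ((*s) :: complex \<Rightarrow> complex^'n::finite \<Rightarrow> complex^'n)"
  unfolding bilinear_conv_bounded_bilinear[symmetric]
  by (auto simp: bilinear_def linear_iff vec_eq_iff algebra_simps)

lemma bounded_linear_cmat: "bounded_linear (cmat :: real^'n::finite^'m::finite \<Rightarrow> _)"
  unfolding linear_conv_bounded_linear[symmetric]
  by (auto simp: linear_iff vec_eq_iff) (simp add: scaleR_conv_of_real)

lemma norm_vec_scale: "norm (c *s (v :: complex^'n::finite)) = norm c * norm v"
  by (simp add: norm_vec_def L2_set_def norm_mult power_mult_distrib sum_distrib_left[symmetric]
      real_sqrt_mult)

text \<open>Eigenvalues are bounded in terms of the norm and eigenvectors may be taken of norm one. So the
  matrices in a closed ball that have an eigenvalue in \<open>C\<close> are the projection of a compact set of triples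
  (matrix, eigenvalue, eigenvector), and thus closed.\<close>

lemma open_spectrum_avoids:
  fixes C :: "complex set"
  assumes C: "closed C"
  shows "open {X :: real^'k::finite^'k. \<forall>z. complex_eigenvalue X z \<longrightarrow> z \<notin> C}" (is "open ?G")
proof (subst open_subopen, safe)
  fix X0 :: "real^'k^'k" assume X0: "\<forall>z. complex_eigenvalue X0 z \<longrightarrow> z \<notin> C"
  obtain K where K: "K > 0" "\<And>(A :: complex^'k^'k) v. norm (A *v v) \<le> norm A * norm v * K"
    using bounded_bilinear.pos_bounded[OF bounded_bilinear_matrix_vector_mult[where 'n='k and 'm='k]]
    by auto
  obtain L where L: "L > 0" "\<And>A :: real^'k^'k. norm (cmat A) \<le> norm A * L"
    using bounded_linear.pos_bounded[OF bounded_linear_cmat[where 'n='k and 'm='k]] by auto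
  define r where "r = (norm X0 + 1) * L * K"
  define T where "T = {t \<in> cball X0 1 \<times> (C \<inter> cball 0 r) \<times> sphere (0 :: complex^'k) 1.
     cmat (fst t) *v snd (snd t) = fst (snd t) *s snd (snd t)}"
  have cont1: "continuous_on UNIV (\<lambda>t :: (real^'k^'k) \<times> complex \<times> (complex^'k). cmat (fst t) *v snd (snd t))"
    by (intro bounded_bilinear.continuous_on[OF bounded_bilinear_matrix_vector_mult]
        bounded_linear.continuous_on[OF bounded_linear_cmat] continuous_intros)
  have cont2: "continuous_on UNIV (\<lambda>t :: (real^'k^'k) \<times> complex \<times> (complex^'k). fst (snd t) *s snd (snd t))"
    by (intro bounded_bilinear.continuous_on[OF bounded_bilinear_vec_scale] continuous_intros)
  have "T = (cball X0 1 \<times> (C \<inter> cball 0 r) \<times> sphere 0 1) \<inter>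
      {t. cmat (fst t) *v snd (snd t) = fst (snd t) *s snd (snd t)}"
    unfolding T_def by auto
  moreover have "compact (cball X0 1 \<times> (C \<inter> cball 0 r) \<times> sphere (0 :: complex^'k) 1)"
    using C by (intro compact_Times closed_Int_compact) auto
  moreover have "closed {t :: (real^'k^'k) \<times> complex \<times> (complex^'k).
      cmat (fst t) *v snd (snd t) = fst (snd t) *s snd (snd t)}"
    by (rule closed_Collect_eq[OF cont1 cont2])
  ultimately have "compact T" by (simp add: compact_Int_closed)
  then have clo: "closed (fst ` T)"
    by (intro compact_imp_closed compact_continuous_image continuous_intros)
  have bad: "X \<in> fst ` T" if X: "X \<in> cball X0 1" "complex_eigenvalue X z" "z \<in> C" for X z
  proof -
    obtain v where v: "v \<noteq> 0" "cmat X *v v = z *s v" using X complex_eigenvalue_def by blast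
    let ?v = "complex_of_real (1 / norm v) *s v"
    have v': "norm ?v = 1" using v(1) by (simp add: norm_vec_scale norm_divide)
    have ev: "cmat X *v ?v = z *s ?v" using v(2) by (simp add: vec.scale mult.commute)
    have "norm X \<le> norm X0 + 1" using X(1) norm_triangle_sub[of X X0] by (simp add: dist_norm norm_minus_commute)
    then have "norm (cmat X) \<le> (norm X0 + 1) * L" using L by (meson mult_right_mono less_imp_le order_trans)
    moreover have "norm (z *s ?v) = norm z" by (simp only: norm_vec_scale[of z ?v] v' mult_1_right)
    then have "norm z \<le> norm (cmat X) * K" using K(2)[of "cmat X" ?v] unfolding v' ev by simp
    ultimately have "norm z \<le> r" unfolding r_def using K(1) by (meson mult_right_mono less_imp_le order_trans)
    then have "(X, z, ?v) \<in> T" using X v' ev unfolding T_def by simp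
    then show ?thesis by force
  qed
  have "X0 \<notin> fst ` T"
  proof
    assume "X0 \<in> fst ` T"
    then obtain z v where "z \<in> C" "norm v = 1" "cmat X0 *v v = z *s v" unfolding T_def by auto
    then show False using X0 unfolding complex_eigenvalue_def by (metis norm_zero zero_neq_one)
  qed
  then show "\<exists>U. open U \<and> X0 \<in> U \<and> U \<subseteq> ?G"
    using clo bad by (intro exI[of _ "ball X0 1 - fst ` T"]) (auto simp: open_Diff)
qed

lemma open_no_nonpos_eigenvalue: "open {A :: real^'k::finite^'k. no_nonpos_eigenvalue A}"
  unfolding no_nonpos_eigenvalue_def by (rule open_spectrum_avoids) simp

lemma open_right_half_spectrum: "open {A :: real^'k::finite^'k. right_half_spectrum A}"
  using open_spectrum_avoids[OF closed_halfspace_Re_le[of 0]]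
  by (simp add: right_half_spectrum_def not_le)

lemma bounded_bilinear_sylvester:
  "bounded_bilinear (\<lambda>X H :: real^'k::finite^'k. X ** H + H ** X)"
proof -
  interpret B: bounded_bilinear "(**) :: real^'k^'k \<Rightarrow> real^'k^'k \<Rightarrow> real^'k^'k"
    by (rule bounded_bilinear_matrix_mult)
  show ?thesis
    unfolding bilinear_conv_bounded_bilinear[symmetric]
    by (auto simp: bilinear_def linear_iff B.add_left B.add_right B.scaleR_left B.scaleR_right scaleR_add_right)
qed

lemma sylvester_injective_real:
  fixes X H :: "real^'k::finite^'k"
  assumes X: "right_half_spectrum X" and "X ** H + H ** X = 0"
  shows "H = 0"
proof -
  have "cmat X ** cmat H + cmat H ** cmat X = 0"
    using assms(2) by (metis cmat_mult cmat_add cmat_0)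
  then have "cmat H = 0"
    using X sylvester_injective[of "cmat X" "cmat X" "cmat H"]
    unfolding right_half_spectrum_def complex_eigenvalue_iff by blast
  then show ?thesis by (metis cmat_0 cmat_eq_iff)
qed

text \<open>The inverse function theorem, applied to squaring on the open set of matrices with spectrum in the
  right half-plane, yields a local inverse with values in that set. It is the principal root there
  because the latter is unique.\<close>

lemma principal_sqrt_differentiable:
  fixes A :: "real^'k::finite^'k"
  assumes A: "no_nonpos_eigenvalue A"
  shows "principal_sqrt differentiable (at A)"
proof -
  interpret B: bounded_bilinear "\<lambda>X H :: real^'k^'k. X ** H + H ** X"
    by (rule bounded_bilinear_sylvester)
  let ?U = "{X :: real^'k^'k. right_half_spectrum X}" and ?X = "principal_sqrt A"
  have X: "?X ** ?X = A" "?X \<in> ?U" using principal_sqrt[OF A] by auto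
  have lin: "linear (B.prod_right ?X)" using blinfun.bounded_linear_right bounded_linear.linear by blast
  have "inj (B.prod_right ?X)"
    by (subst linear_injective_0[OF lin]) (use X(2) in \<open>auto intro: sylvester_injective_real\<close>)
  then obtain T where T: "linear T" "T \<circ> B.prod_right ?X = id"
    using linear_injective_left_inverse[OF lin] by blast
  have inv: "Blinfun T o\<^sub>L B.prod_right ?X = id_blinfun"
    using T(1) fun_cong[OF T(2)]
    by (intro blinfun_eqI) (simp add: bounded_linear_Blinfun_apply linear_conv_bounded_linear o_def)
  have der: "((\<lambda>X. X ** X) has_derivative blinfun_apply (B.prod_right X)) (at X)" for X
    using matrix_mult_has_derivative[OF has_derivative_ident has_derivative_ident, of X UNIV] by simp
  have cont: "continuous_on ?U B.prod_right"
    by (intro linear_continuous_on B.bounded_linear_prod_right)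
  obtain U' V g g' where "open U'" and U': "U' \<subseteq> ?U" and "?X \<in> U'" and V: "open V" "?X ** ?X \<in> V"
      and hom: "homeomorphism U' V (\<lambda>X. X ** X) g"
      and g: "\<And>y. y \<in> V \<Longrightarrow> (g has_derivative g' y) (at y)"
      and "\<And>y. y \<in> V \<Longrightarrow> g' y = inv (B.prod_right (g y))" "\<And>y. y \<in> V \<Longrightarrow> bij (B.prod_right (g y))"
    by (rule inverse_function_theorem[OF open_right_half_spectrum der cont X(2) inv]) blast+
  have "g y = principal_sqrt y" if "y \<in> V" for y
    using hom U' that by (intro principal_sqrt_eqI[symmetric]) (auto simp: homeomorphism_def)
  then have "(principal_sqrt has_derivative g' A) (at A)"
    using has_derivative_transform_within_open[OF g[OF V(2)] V] X(1) by simp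
  then show ?thesis using differentiableI by blast
qed

text \<open>Differentiating \<open>S A ** S A = A\<close> shows that the derivative of the root \<open>S\<close> in direction \<open>v\<close> solves
  \<open>S A ** h + h ** S A = v\<close>. The solution is as smooth as \<open>S\<close>, so \<open>S\<close> gains one derivative.\<close>

lemma C_k_on_principal_sqrt:
  "C_k_on k {A :: real^'k::finite^'k. no_nonpos_eigenvalue A} principal_sqrt"
proof (induction k)
  let ?Q = "{A :: real^'k::finite^'k. no_nonpos_eigenvalue A}"
  case 0
  show ?case
    by (auto intro!: continuous_at_imp_continuous_on differentiable_imp_continuous_within
        principal_sqrt_differentiable)
next
  let ?Q = "{A :: real^'k::finite^'k. no_nonpos_eigenvalue A}"
  let ?S = "principal_sqrt :: real^'k^'k \<Rightarrow> _"
  let ?S' = "\<lambda>A. frechet_derivative ?S (at A)"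
  case (Suc k)
  have eq: "?S A ** ?S' A v + ?S' A v ** ?S A = v" if A: "A \<in> ?Q" for A v
  proof -
    have S': "(?S has_derivative ?S' A) (at A)"
      using A principal_sqrt_differentiable frechet_derivative_works by blast
    have "((\<lambda>A. ?S A ** ?S A) has_derivative (\<lambda>v. ?S A ** ?S' A v + ?S' A v ** ?S A)) (at A)"
      by (rule matrix_mult_has_derivative[OF S' S'])
    then have "((\<lambda>A. A) has_derivative (\<lambda>v. ?S A ** ?S' A v + ?S' A v ** ?S A)) (at A)"
      by (rule has_derivative_transform_within_open[OF _ open_no_nonpos_eigenvalue A])
        (simp add: principal_sqrt(1))
    from has_derivative_unique[OF has_derivative_ident this] show ?thesis by (simp add: fun_eq_iff)
  qed
  have "C_k_on k ?Q (\<lambda>A. ?S' A v)" for v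
    by (rule C_k_on_bilinear_solution[OF bounded_bilinear_sylvester open_no_nonpos_eigenvalue eq
          _ Suc.IH C_k_on_const[OF open_no_nonpos_eigenvalue]])
      (use sylvester_injective_real principal_sqrt(2) in auto)
  then show ?case using principal_sqrt_differentiable by auto
qed

text \<open>The inverse is the solution \<open>h\<close> of the bilinear equation \<open>f x ** h = mat 1\<close>.\<close>

lemma C_k_on_matrix_inv:
  fixes f :: "'a::euclidean_space \<Rightarrow> real^'k::finite^'k"
  assumes "open W" "\<And>x. x \<in> W \<Longrightarrow> invertible (f x)" "C_k_on k W f"
  shows "C_k_on k W (\<lambda>x. matrix_inv (f x))"
proof (rule C_k_on_bilinear_solution[OF bounded_bilinear_matrix_mult assms(1) _ _ assms(3) C_k_on_const[OF assms(1)]])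
  show "f x ** matrix_inv (f x) = mat 1" if "x \<in> W" for x using matrix_inv_mult assms(2) that by blast
  show "h = 0" if "x \<in> W" "f x ** h = 0" for x and h :: "real^'k^'k"
    by (metis assms(2) that matrix_inv_mult(2) matrix_mul_assoc matrix_mul_lid mat_mult_zero_right)
qed

section \<open>Symplectic matrices\<close>

lemma sum_UNIV_Plus: "(\<Sum>k\<in>(UNIV :: ('a::finite + 'b::finite) set). f k) = (\<Sum>a\<in>UNIV. f (Inl a)) + (\<Sum>b\<in>UNIV. f (Inr b))"
  by (simp add: UNIV_Plus_UNIV[symmetric] sum.Plus del: UNIV_Plus_UNIV)

lemma transpose_Jmat: "transpose Jmat = - Jmat"
  by (auto simp: vec_eq_iff transpose_def Jmat_def split: sum.splits)

lemma Jmat_mult_Jmat: "Jmat ** Jmat = - (mat 1 :: real^('k::finite + 'k)^('k + 'k))"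
  by (auto simp: vec_eq_iff split_sum_all matrix_matrix_mult_def sum_UNIV_Plus Jmat_def mat_def
      if_distrib if_distribR cong: if_cong)

lemma Jmat_mult_Jmat_left: "Jmat ** (Jmat ** A) = - A"
  by (simp add: matrix_mul_assoc Jmat_mult_Jmat mat_mult_minus_left)

lemmas mat_ring_simps = mat_mult_diff_left mat_mult_diff_right mat_mult_add_left matrix_add_ldistrib
  mat_mult_minus_left mat_mult_minus_right mat_mult_zero_left mat_mult_zero_right
  matrix_mul_assoc[symmetric] matrix_transpose_mul transpose_minus transpose_add transpose_diff
  transpose_Jmat Jmat_mult_Jmat Jmat_mult_Jmat_left

lemma SpSt_iff: "U \<in> SpSt \<longleftrightarrow> transpose U ** Jmat ** U = Jmat"
proof -
  have "transpose Jmat ** B = mat 1 \<longleftrightarrow> B = Jmat" for B :: "real^('a + 'a)^('a + 'a)"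
  proof
    assume "transpose Jmat ** B = mat 1"
    then have "Jmat ** (transpose Jmat ** B) = Jmat" by simp
    then show "B = Jmat" by (simp add: mat_ring_simps)
  qed (simp add: mat_ring_simps)
  then show ?thesis by (simp add: SpSt_def sp_inv_def matrix_mul_assoc[symmetric])
qed

lemma Jmat_sp_inv: "Jmat ** (sp_inv U ** D) = transpose U ** (Jmat ** D)"
  by (simp add: sp_inv_def mat_ring_simps)

lemma hamiltonianD: "H \<in> hamiltonian \<Longrightarrow> transpose H ** Jmat = - (Jmat ** H)"
  by (simp add: hamiltonian_def mat_ring_simps minus_equation_iff)

text \<open>Along \<open>t \<mapsto> exp (t H)\<close> the form \<open>exp (t H)\<^sup>T J exp (t H)\<close> has derivative
  \<open>exp (t H)\<^sup>T (H\<^sup>T J + J H) exp (t H) = 0\<close>.\<close>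

lemma mat_exp_hamiltonian_symplectic:
  assumes H: "H \<in> hamiltonian"
  shows "transpose (mat_exp H) ** (Jmat ** mat_exp H) = Jmat"
proof -
  let ?E = "\<lambda>t. mat_exp (t *\<^sub>R H)"
  let ?f = "\<lambda>t. transpose (?E t) ** (Jmat ** ?E t)"
  interpret B: bounded_bilinear "(**) :: real^('a + 'a)^('a + 'a) \<Rightarrow> real^('a + 'a)^('a + 'a) \<Rightarrow> _"
    by (rule bounded_bilinear_matrix_mult)
  have "(?f has_derivative (\<lambda>s. 0)) (at t within UNIV)" for t
  proof -
    have "(?f has_derivative (\<lambda>s. transpose (?E t) ** (Jmat ** (s *\<^sub>R (H ** ?E t)))
        + transpose (s *\<^sub>R (H ** ?E t)) ** (Jmat ** ?E t))) (at t)"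
      by (rule matrix_mult_has_derivative[OF
            bounded_linear.has_derivative[OF bounded_linear_transpose mat_exp_curve_has_derivative]
            bounded_linear.has_derivative[OF B.bounded_linear_right mat_exp_curve_has_derivative]])
    moreover have "transpose (?E t) ** (Jmat ** (s *\<^sub>R (H ** ?E t)))
        + transpose (s *\<^sub>R (H ** ?E t)) ** (Jmat ** ?E t) = 0" for s
    proof -
      have "transpose H ** (Jmat ** ?E t) = - (Jmat ** (H ** ?E t))"
        using hamiltonianD[OF H] by (simp add: matrix_mul_assoc mat_mult_minus_left)
      then show ?thesis
        by (simp add: linear_cmul[OF bounded_linear.linear[OF bounded_linear_transpose]]
            B.scaleR_left B.scaleR_right mat_ring_simps)
    qed
    ultimately show ?thesis by simp
  qed
  then obtain c where c: "\<forall>t\<in>UNIV. ?f t = c" using has_derivative_zero_constant[OF convex_UNIV] by blast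
  have "?f 1 = ?f 0" unfolding bspec[OF c UNIV_I] ..
  then show ?thesis by (simp add: mat_exp_0)
qed

text \<open>The matrix \<open>\<Delta>\<close>; the factor \<open>Gf U D\<close> corrects it to a symplectic one.\<close>

definition pre_retraction ::
  "real^('p::finite + 'p)^('n::finite + 'n) \<Rightarrow> real^('p + 'p)^('n + 'n) \<Rightarrow> real^('p + 'p)^('n + 'n)" where
  "pre_retraction U D = U ** mat_exp (sp_inv U ** D) + (mat 1 - U ** sp_inv U) ** D"

lemma Rf_eq: "Rf U D = pre_retraction U D ** Gf U D"
  by (simp add: Rf_def pre_retraction_def)

text \<open>The range of \<open>W = D - U H\<close> is orthogonal to that of \<open>U\<close> with respect to \<open>J\<close>. Hence the form splits
  into \<open>exp (H)\<^sup>T J exp (H) = J\<close> and \<open>W\<^sup>T J W = D\<^sup>T J D - H\<^sup>T J H\<close>.\<close>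

lemma Kmat_eq_pre_retraction:
  assumes U: "U \<in> SpSt" and D: "D \<in> SpSt_tangent U"
  shows "transpose (pre_retraction U D) ** Jmat ** pre_retraction U D = Kmat U D"
proof -
  define H where "H = sp_inv U ** D"
  define W where "W = D - U ** H"
  define E where "E = mat_exp H"
  have H: "H \<in> hamiltonian" using D by (simp add: SpSt_tangent_def H_def)
  have UJU: "transpose U ** (Jmat ** (U ** A)) = Jmat ** A" for A
    using U by (simp add: SpSt_iff matrix_mul_assoc)
  have UJD: "transpose U ** (Jmat ** D) = Jmat ** H" by (simp add: H_def Jmat_sp_inv)
  have UJW: "transpose U ** (Jmat ** W) = 0" by (simp add: W_def mat_ring_simps UJD UJU)
  have "transpose (transpose U ** (Jmat ** W)) = 0" unfolding UJW by (simp add: transpose_def vec_eq_iff)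
  then have WJU0: "transpose W ** (Jmat ** U) = 0" by (simp add: mat_ring_simps)
  have WJU: "transpose W ** (Jmat ** (U ** A)) = 0" for A
    using arg_cong[OF WJU0, of "\<lambda>B. B ** A"] by (simp add: mat_ring_simps)
  have EJE: "transpose E ** (Jmat ** E) = Jmat" using mat_exp_hamiltonian_symplectic[OF H] by (simp add: E_def)
  have "transpose W ** (Jmat ** W) = transpose W ** (Jmat ** D)"
    using WJU[of H] by (simp add: W_def mat_ring_simps)
  also have "\<dots> = transpose D ** (Jmat ** D) - transpose H ** (Jmat ** H)"
    by (simp add: W_def mat_ring_simps UJD)
  finally have WJW: "transpose W ** (Jmat ** W) = transpose D ** (Jmat ** D) - transpose H ** (Jmat ** H)" .
  have \<Delta>: "pre_retraction U D = U ** E + W"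
    by (simp add: pre_retraction_def E_def W_def H_def mat_ring_simps)
  have "transpose (U ** E + W) ** Jmat ** (U ** E + W)
      = transpose E ** (Jmat ** E) + transpose W ** (Jmat ** W)"
    by (simp add: mat_ring_simps UJU UJW WJU)
  then show ?thesis
    unfolding \<Delta> EJE WJW by (simp add: Kmat_def H_def matrix_mul_assoc[symmetric] add_diff_eq)
qed

lemma transpose_Kmat: "transpose (Kmat U D) = - Kmat U D"
  by (simp add: Kmat_def mat_ring_simps)

lemma right_half_spectrum_invertible:
  fixes X :: "real^'k::finite^'k"
  assumes "right_half_spectrum X" shows "invertible X"
proof -
  have "x = 0" if x: "X *v x = 0" for x
  proof (rule ccontr)
    assume "x \<noteq> 0"
    let ?v = "\<chi> i. complex_of_real (x $ i)"
    have "(\<Sum>j\<in>UNIV. X $ i $ j * x $ j) = 0" for i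
      using x by (simp add: vec_eq_iff matrix_vector_mult_def)
    then have "complex_of_real (\<Sum>j\<in>UNIV. X $ i $ j * x $ j) = 0" for i by simp
    then have "cmat X *v ?v = 0 *s ?v" by (simp add: vec_eq_iff matrix_vector_mult_def)
    moreover have "?v \<noteq> 0" using \<open>x \<noteq> 0\<close> by (simp add: vec_eq_iff)
    ultimately have "complex_eigenvalue X 0" unfolding complex_eigenvalue_def by blast
    then show False using assms unfolding right_half_spectrum_def by fastforce
  qed
  then show ?thesis unfolding invertible_left_inverse matrix_left_invertible_ker by blast
qed

text \<open>Skewness of \<open>K\<close> says that \<open>N = - K J\<close> is similar to its transpose by way of \<open>J\<close>. Therefore
  \<open>Y = J M\<^sup>T J\<^sup>-\<^sup>1\<close> is a square root of \<open>N\<close> with the spectrum of \<open>M\<close>, and uniqueness forces \<open>Y = M\<close>.\<close>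

lemma principal_sqrt_skew_factor:
  fixes K :: "real^('p::finite + 'p)^('p + 'p)"
  assumes K: "transpose K = - K" and dom: "no_nonpos_eigenvalue (- K ** Jmat)"
  defines "M \<equiv> principal_sqrt (- K ** Jmat)"
  shows "M ** (Jmat ** transpose M) = K"
proof -
  have M: "M ** M = - K ** Jmat" "right_half_spectrum M"
    using principal_sqrt[OF dom] by (simp_all add: M_def)
  define Y where "Y = - (Jmat ** (transpose M ** Jmat))"
  have "transpose M ** transpose M = - (Jmat ** K)"
    using arg_cong[OF M(1), of transpose] by (simp add: mat_ring_simps K)
  then have MtMt: "transpose M ** (transpose M ** A) = - (Jmat ** (K ** A))" for A
    by (simp add: matrix_mul_assoc mat_mult_minus_left)
  have "Y ** Y = M ** M" unfolding M(1) by (simp add: Y_def mat_ring_simps MtMt)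
  moreover have "right_half_spectrum Y"
    unfolding right_half_spectrum_def
  proof safe
    fix z assume "complex_eigenvalue Y z"
    moreover have "Jmat ** Y = transpose M ** Jmat" by (simp add: Y_def mat_ring_simps)
    moreover have "invertible (Jmat :: real^('p + 'p)^('p + 'p))"
      unfolding invertible_left_inverse by (intro exI[of _ "- Jmat"]) (simp add: mat_ring_simps)
    ultimately have "complex_eigenvalue (transpose M) z" using complex_eigenvalue_similar by blast
    then show "Re z > 0" using M(2) by (simp add: complex_eigenvalue_transpose right_half_spectrum_def)
  qed
  ultimately have "Y = M" using principal_sqrt_unique M(2) by blast
  moreover have "Y ** Jmat = Jmat ** transpose M" by (simp add: Y_def mat_ring_simps)
  ultimately have "M ** Jmat = Jmat ** transpose M" by simp
  then have "M ** (Jmat ** transpose M) = (M ** M) ** Jmat" by (simp add: matrix_mul_assoc[symmetric])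
  then show ?thesis unfolding M(1) by (simp add: mat_ring_simps)
qed

lemma Rf_in_SpSt:
  assumes U: "U \<in> SpSt" and D: "D \<in> Gf_dom U"
  shows "Rf U D \<in> SpSt"
proof -
  define M where "M = principal_sqrt (- Kmat U D ** Jmat)"
  have dom: "no_nonpos_eigenvalue (- Kmat U D ** Jmat)" and T: "D \<in> SpSt_tangent U"
    using D by (simp_all add: Gf_dom_def)
  have "invertible (transpose M)"
    using transpose_invertible[OF right_half_spectrum_invertible[OF principal_sqrt(2)[OF dom]]]
    by (simp add: M_def)
  then have MG: "transpose M ** Gf U D = mat 1" by (simp add: Gf_def M_def matrix_inv_mult)
  have GM: "transpose (Gf U D) ** M = mat 1"
    using arg_cong[OF MG, of transpose] by (simp add: matrix_transpose_mul)
  have "transpose (Rf U D) ** Jmat ** Rf U D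
      = transpose (Gf U D) ** (transpose (pre_retraction U D) ** Jmat ** pre_retraction U D) ** Gf U D"
    by (simp add: Rf_eq matrix_transpose_mul matrix_mul_assoc)
  also have "\<dots> = transpose (Gf U D) ** (M ** (Jmat ** transpose M)) ** Gf U D"
    unfolding Kmat_eq_pre_retraction[OF U T] M_def
    using principal_sqrt_skew_factor[OF transpose_Kmat dom] by simp
  also have "\<dots> = (transpose (Gf U D) ** M) ** Jmat ** (transpose M ** Gf U D)"
    by (simp add: matrix_mul_assoc)
  finally show ?thesis by (simp add: MG GM SpSt_iff)
qed

section \<open>The retraction\<close>

lemma complex_eigenvalue_mat_1:
  assumes "complex_eigenvalue (mat 1 :: real^'k::finite^'k) z" shows "z = 1"
proof -
  obtain v :: "complex^'k" where v: "v \<noteq> 0" "cmat (mat 1) *v v = z *s v"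
    using assms unfolding complex_eigenvalue_def by blast
  then obtain i where "v $ i \<noteq> 0" by (auto simp: vec_eq_iff)
  moreover have "v $ i = z * v $ i"
    using arg_cong[OF v(2), of "\<lambda>w. w $ i"] by (simp add: cmat_mat)
  ultimately show ?thesis by simp
qed

lemma principal_sqrt_mat_1: "principal_sqrt (mat 1 :: real^'k::finite^'k) = mat 1"
  by (rule principal_sqrt_eqI) (auto simp: right_half_spectrum_def dest: complex_eigenvalue_mat_1)

lemma no_nonpos_eigenvalue_mat_1: "no_nonpos_eigenvalue (mat 1 :: real^'k::finite^'k)"
  by (auto simp: no_nonpos_eigenvalue_def dest: complex_eigenvalue_mat_1)

lemma minus_Kmat_0_Jmat: "- Kmat U 0 ** Jmat = mat 1"
  by (simp add: Kmat_def mat_ring_simps)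

lemma Gf_0: "Gf U 0 = mat 1"
  by (simp add: Gf_def minus_Kmat_0_Jmat principal_sqrt_mat_1 matrix_inv_mat_1)

lemma Rf_0: "Rf U 0 = U"
  by (simp add: Rf_def Gf_0 mat_exp_0)

lemma zero_in_Gf_dom: "0 \<in> Gf_dom U"
  by (simp add: Gf_dom_def SpSt_tangent_def hamiltonian_def minus_Kmat_0_Jmat no_nonpos_eigenvalue_mat_1)
    (simp add: transpose_def vec_eq_iff)

lemmas C_k_on_mult = C_k_on_bilinear[OF bounded_bilinear_matrix_mult]
lemmas C_k_on_transpose = C_k_on_linear_compose[OF bounded_linear_transpose]

lemma C_k_on_sp_inv:
  assumes W: "open W" and f: "C_k_on k W f" shows "C_k_on k W (\<lambda>x. sp_inv (f x))"
  unfolding sp_inv_def by (intro C_k_on_mult C_k_on_transpose C_k_on_const W f)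

lemma C_k_on_Kmat:
  assumes W: "open W" and f: "C_k_on k W f" "C_k_on k W g" shows "C_k_on k W (\<lambda>x. Kmat (f x) (g x))"
  unfolding Kmat_def
  by (intro C_k_on_add C_k_on_diff C_k_on_mult C_k_on_transpose C_k_on_sp_inv C_k_on_const W f)

text \<open>The outer function of \<open>Gf\<close>, separated from the polynomial map \<open>D \<mapsto> - Kmat U D ** Jmat\<close>.\<close>

definition inv_transpose_sqrt :: "real^'k::finite^'k \<Rightarrow> real^'k^'k" where
  "inv_transpose_sqrt A = matrix_inv (transpose (principal_sqrt A))"

lemma C_k_on_inv_transpose_sqrt: "C_k_on k {A :: real^'k::finite^'k. no_nonpos_eigenvalue A} inv_transpose_sqrt"
  unfolding inv_transpose_sqrt_def
  by (intro C_k_on_matrix_inv C_k_on_transpose C_k_on_principal_sqrt open_no_nonpos_eigenvalue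
      transpose_invertible right_half_spectrum_invertible principal_sqrt(2)) auto

text \<open>The trace of this open set on the tangent bundle is the bundle of domains of the retraction, so one and
  the same formula serves as the smooth extension near every point of that bundle.\<close>

lemma Rf_C_k_on_open_domain:
  fixes W defines "W \<equiv> {x :: (real^('p::finite + 'p)^('n::finite + 'n)) \<times> (real^('p + 'p)^('n + 'n)).
     no_nonpos_eigenvalue (- Kmat (fst x) (snd x) ** Jmat)}"
  shows "open W" "C_k_on k W (\<lambda>x. Rf (fst x) (snd x))"
proof -
  let ?N = "\<lambda>x :: (real^('p + 'p)^('n + 'n)) \<times> (real^('p + 'p)^('n + 'n)). - Kmat (fst x) (snd x) ** Jmat"
  have fs: "C_k_on k V fst" "C_k_on k V snd" if "open V"
    for k and V :: "((real^('p + 'p)^('n + 'n)) \<times> (real^('p + 'p)^('n + 'n))) set"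
    using that by (auto intro: C_k_on_linear bounded_linear_fst bounded_linear_snd)
  have N: "C_k_on k V ?N" if "open V" for k V
    by (intro C_k_on_mult C_k_on_uminus C_k_on_Kmat C_k_on_const fs that)
  have "W = ?N -` {A. no_nonpos_eigenvalue A}" by (auto simp: W_def)
  then show W: "open W"
    using continuous_on_open_vimage[OF open_UNIV, of ?N] N[of UNIV 0] open_no_nonpos_eigenvalue by auto
  have "C_k_on k W (\<lambda>x. inv_transpose_sqrt (?N x))"
    by (rule C_k_on_compose[OF W open_no_nonpos_eigenvalue _ C_k_on_inv_transpose_sqrt N[OF W]]) (auto simp: W_def)
  moreover have "C_k_on k W (\<lambda>x. mat_exp (sp_inv (fst x) ** snd x))"
    by (rule C_k_on_compose[OF W open_UNIV _ C_k_on_mat_exp])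
      (auto intro!: C_k_on_mult C_k_on_sp_inv fs W)
  ultimately show "C_k_on k W (\<lambda>x. Rf (fst x) (snd x))"
    unfolding Rf_def Gf_def inv_transpose_sqrt_def[symmetric]
    by (intro C_k_on_mult C_k_on_add C_k_on_diff C_k_on_sp_inv C_k_on_const fs W)
qed

text \<open>\<open>Kmat U\<close> is stationary at \<open>0\<close>, so only \<open>pre_retraction\<close> contributes to the derivative.\<close>

lemma Rf_has_derivative_0:
  fixes U :: "real^('p::finite + 'p)^('n::finite + 'n)"
  shows "(Rf U has_derivative (\<lambda>v. v)) (at 0)"
proof -
  note linear_right = bounded_linear_imp_has_derivative[OF
      bounded_bilinear.bounded_linear_right[OF bounded_bilinear_matrix_mult]]
  let ?L = "\<lambda>D :: real^('p + 'p)^('n + 'n). sp_inv U ** D"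
  \<comment> \<open>both nonconstant summands of \<open>Kmat\<close> have this shape, one with \<open>A = mat 1\<close>\<close>
  have q: "((\<lambda>D :: real^('p + 'p)^('n + 'n). transpose (A ** D) ** Jmat ** (A ** D)) has_derivative (\<lambda>v. 0)) (at 0)"
    for A :: "real^('n + 'n)^('q::finite + 'q)"
  proof -
    have A: "((\<lambda>D :: real^('p + 'p)^('n + 'n). A ** D) has_derivative (\<lambda>D. A ** D)) (at 0)" by (rule linear_right)
    have t: "((\<lambda>D :: real^('p + 'p)^('n + 'n). transpose (A ** D)) has_derivative (\<lambda>D. transpose (A ** D))) (at 0)"
      by (rule bounded_linear.has_derivative[OF bounded_linear_transpose A])
    have j: "((\<lambda>D :: real^('p + 'p)^('n + 'n). Jmat ** (A ** D)) has_derivative (\<lambda>D. Jmat ** (A ** D))) (at 0)"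
      by (rule bounded_linear.has_derivative[OF
            bounded_bilinear.bounded_linear_right[OF bounded_bilinear_matrix_mult] A])
    have "((\<lambda>D :: real^('p + 'p)^('n + 'n). transpose (A ** D) ** (Jmat ** (A ** D))) has_derivative
       (\<lambda>v. transpose (A ** 0) ** (Jmat ** (A ** v)) + transpose (A ** v) ** (Jmat ** (A ** 0)))) (at 0)"
      by (rule matrix_mult_has_derivative[OF t j])
    moreover have "transpose (0 :: real^('p + 'p)^('q + 'q)) = 0" by (simp add: transpose_def vec_eq_iff)
    ultimately show ?thesis by (simp add: matrix_mul_assoc)
  qed
  have "((\<lambda>D. Jmat + transpose (mat 1 ** D) ** Jmat ** (mat 1 ** D)
      - transpose (?L D) ** Jmat ** ?L D) has_derivative (\<lambda>v. 0 + 0 - 0)) (at 0)"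
    by (intro has_derivative_add has_derivative_diff has_derivative_const q)
  then have "(Kmat U has_derivative (\<lambda>v. 0)) (at 0)"
    by (simp add: Kmat_def[abs_def])
  then have N: "((\<lambda>D. - Kmat U D ** Jmat) has_derivative (\<lambda>v. 0)) (at 0)"
    using bounded_linear.has_derivative[OF bounded_bilinear.bounded_linear_left[OF bounded_bilinear_matrix_mult]
        has_derivative_minus] by (fastforce simp: mat_mult_zero_left)
  have "inv_transpose_sqrt differentiable (at (mat 1 :: real^('p + 'p)^('p + 'p)))"
    using C_k_on_inv_transpose_sqrt[of "Suc 0"] no_nonpos_eigenvalue_mat_1 by auto
  then obtain G' where G': "(inv_transpose_sqrt has_derivative G') (at (mat 1 :: real^('p + 'p)^('p + 'p)))"
    unfolding differentiable_def by blast
  have "G' 0 = 0" using G' has_derivative_linear linear_0 by blast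
  have "((\<lambda>D. inv_transpose_sqrt (- Kmat U D ** Jmat)) has_derivative (\<lambda>v. G' 0)) (at 0)"
    by (rule has_derivative_compose[OF N]) (simp add: minus_Kmat_0_Jmat G')
  then have G: "(Gf U has_derivative (\<lambda>v. 0)) (at 0)"
    by (simp add: \<open>G' 0 = 0\<close> Gf_def[abs_def] inv_transpose_sqrt_def)
  have "((\<lambda>D. mat_exp (?L D)) has_derivative (\<lambda>v. ?L v)) (at 0)"
    by (rule has_derivative_compose[OF linear_right]) (simp add: mat_exp_has_derivative_0)
  then have "(pre_retraction U has_derivative (\<lambda>v. U ** ?L v + (mat 1 - U ** sp_inv U) ** v)) (at 0)"
    unfolding pre_retraction_def[abs_def]
    by (intro has_derivative_add linear_right bounded_linear.has_derivative[OF
      bounded_bilinear.bounded_linear_right[OF bounded_bilinear_matrix_mult]])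
  then have \<Delta>: "(pre_retraction U has_derivative (\<lambda>v. v)) (at 0)"
    by (simp add: mat_ring_simps)
  have "((\<lambda>D. pre_retraction U D ** Gf U D) has_derivative
      (\<lambda>v. pre_retraction U 0 ** 0 + v ** Gf U 0)) (at 0)"
    by (rule matrix_mult_has_derivative[OF \<Delta> G])
  then show ?thesis by (simp add: Gf_0 Rf_eq[abs_def])
qed

theorem theorem1:
  assumes "CARD('p::finite) \<le> CARD('n::finite)"
  shows "is_retraction (SpSt :: (real^('p + 'p)^('n + 'n)) set) SpSt_tangent Gf_dom Rf"
proof -
  let ?M = "SpSt :: (real^('p + 'p)^('n + 'n)) set"
  define W where "W = {x :: (real^('p + 'p)^('n + 'n)) \<times> (real^('p + 'p)^('n + 'n)).
     no_nonpos_eigenvalue (- Kmat (fst x) (snd x) ** Jmat)}"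
  have W: "open W" "\<And>k. C_k_on k W (\<lambda>x. Rf (fst x) (snd x))"
    unfolding W_def by (rule Rf_C_k_on_open_domain)+
  have dom_eq: "Sigma ?M Gf_dom = Sigma ?M SpSt_tangent \<inter> W"
    by (auto simp: Gf_dom_def W_def)
  have "openin (top_of_set (SpSt_tangent U)) (Gf_dom U)" for U :: "real^('p + 'p)^('n + 'n)"
  proof -
    have "open (Pair U -` W)" by (intro open_vimage W continuous_intros)
    moreover have "Gf_dom U = SpSt_tangent U \<inter> Pair U -` W" by (auto simp: Gf_dom_def W_def)
    ultimately show ?thesis using openin_open_Int by simp
  qed
  moreover have "openin (top_of_set (Sigma ?M SpSt_tangent)) (Sigma ?M Gf_dom)"
    unfolding dom_eq by (rule openin_open_Int[OF W(1)])
  moreover have "smooth_map_on (Sigma ?M Gf_dom) (\<lambda>(x, v). Rf x v)"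
    unfolding smooth_map_on_def dom_eq
    by (intro ballI exI[of _ W] exI[of _ "\<lambda>x. Rf (fst x) (snd x)"]) (use W in auto)
  ultimately show ?thesis
    unfolding is_retraction_def
    using zero_in_Gf_dom Rf_in_SpSt Rf_0 has_derivative_at_withinI[OF Rf_has_derivative_0] by auto
qed

end
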